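(* Let $d \ge 3$ and $n \ge 1$ be integers, let $\mathbb{k}$ be an algebraically closed field with $\operatorname{char}\mathbb{k} = 0$ or $\operatorname{char}\mathbb{k} > d$, and let $f \in \mathbb{k}[x_1,\dots,x_n]$ be a nondegenerate form of degree $d$. Suppose $Z(f)$ is semisimple. Then the following are equivalent: $f$ is indecomposable (i.e. not a direct sum); $\dim_{\mathbb{k}} Z(f) = 1$; $\operatorname{Rank} B = n^2 - 1$, where $B$ is the $n^d\times n^2$ matrix associated to $f$ defined in the context.
   Context: A form of degree $d$ in $n$ variables is a homogeneous polynomial of degree $d$ in $\mathbb{k}[x_1,\dots,x_n]$ (a linear combination of monomials of degree $d$). It is nondegenerate if no variable can be removed by an invertible linear change of variables; equivalently, its first partial derivatives are linearly independent over $\mathbb{k}$. A form $f$ is called a direct sum if, after an invertible linear change of variables, it can be written as a sum of $t\ge 2$ forms in disjoint (nonempty) sets of variables, $f = f_1(x_1,\dots,x_{a_1}) + \cdots + f_t(x_{a_{t-1}+1},\dots,x_n)$; otherwise $f$ is called indecomposable. For $f$ with Hessian matrix $H = \left(\frac{\partial^2 f}{\partial x_i \partial x_j}\right)_{1\le i,j\le n}$, the center of $f$ is $$Z(f) := \{X \in \mathbb{k}^{n\times n} \mid (HX)^T = HX\}.$$ It is known that for $f$ nondegenerate, $Z(f)$ is a commutative subalgebra of $\mathbb{k}^{n\times n}$; semisimplicity refers to this finite-dimensional $\mathbb{k}$-algebra. The matrix $B$: write $f = \sum_{1\le i_1,\dots,i_d\le n} a_{i_1\cdots i_d} x_{i_1}\cdots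 x_{i_d}$ with $a_{i_1\cdots i_d}\in\mathbb{k}$ invariant under all permutations of the subscripts. For $1 \le i_3,\dots,i_d \le n$ let $A^{(i_3\cdots i_d)}$ be the $n\times n$ matrix $(a_{i_1 i_2 i_3\cdots i_d})_{1\le i_1,i_2\le n}$. For an $n\times n$ matrix $X$ let $X_{\mathrm v}$ be the $n^2$-dimensional column vector obtained by stacking the columns of $X$ (first column on top), and let $P$ be the $n^2\times n^2$ permutation matrix with $(X^T)_{\mathrm v} = P X_{\mathrm v}$ for all $X$. Then $B$ is the $n^d\times n^2$ matrix obtained by stacking vertically, over all $(i_3,\dots,i_d)\in\{1,\dots,n\}^{d-2}$ (from $(1,\dots,1)$ to $(n,\dots,n)$), the $n^2\times n^2$ blocks $$I_n\otimes A^{(i_3\cdots i_d)} - (A^{(i_3\cdots i_d)}\otimes I_n)P,$$ where $\otimes$ is the Kronecker product. *)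

theory Defs
  imports
    "HOL-Library.Poly_Mapping"
    "HOL-Computational_Algebra.Polynomial"
    "HOL-Combinatorics.Multiset_Permutations"
    "HOL-Algebra.AbelCoset"
    "Jordan_Normal_Form.DL_Rank"
begin

section \<open>Forms\<close>

text \<open>
  Polynomials in countably many variables indexed by the natural numbers; a polynomial in
  $n$ variables only involves the variables with indices in \<open>{..<n}\<close>, that is, all
  indices in this development start at 0.
\<close>

type_synonym 'a mpoly = "(nat \<Rightarrow>\<^sub>0 nat) \<Rightarrow>\<^sub>0 'a"

definition Const :: "'a::zero \<Rightarrow> 'a mpoly" where
  "Const c = Poly_Mapping.single 0 c"

definition Var :: "nat \<Rightarrow> 'a::zero_neq_one mpoly" where
  "Var i = Poly_Mapping.single (Poly_Mapping.single i 1) 1"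

definition vars :: "'a::zero mpoly \<Rightarrow> nat set" where
  "vars f = (\<Union>m\<in>Poly_Mapping.keys f. Poly_Mapping.keys m)"

definition form :: "nat set \<Rightarrow> nat \<Rightarrow> 'a::zero mpoly \<Rightarrow> bool" where
  "form V d f \<longleftrightarrow> vars f \<subseteq> V \<and>
     (\<forall>m\<in>Poly_Mapping.keys f. (\<Sum>i\<in>Poly_Mapping.keys m. Poly_Mapping.lookup m i) = d)"

definition pderiv_var :: "nat \<Rightarrow> 'a::comm_semiring_1 mpoly \<Rightarrow> 'a mpoly" where
  "pderiv_var i f = (\<Sum>m\<in>Poly_Mapping.keys f.
     Poly_Mapping.single (m - Poly_Mapping.single i 1)
       (of_nat (Poly_Mapping.lookup m i) * Poly_Mapping.lookup f m))"

definition subst :: "(nat \<Rightarrow> 'a mpoly) \<Rightarrow> 'a::comm_semiring_1 mpoly \<Rightarrow> 'a mpoly" where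
  "subst \<sigma> f = (\<Sum>m\<in>Poly_Mapping.keys f. Const (Poly_Mapping.lookup f m) *
     (\<Prod>i\<in>Poly_Mapping.keys m. \<sigma> i ^ Poly_Mapping.lookup m i))"

definition GL :: "nat \<Rightarrow> 'a::semiring_1 mat set" where
  "GL n = {P \<in> carrier_mat n n. invertible_mat P}"

definition change_vars :: "nat \<Rightarrow> 'a mat \<Rightarrow> 'a::comm_semiring_1 mpoly \<Rightarrow> 'a mpoly" where
  "change_vars n P = subst (\<lambda>i. \<Sum>j<n. Const (P $$ (i, j)) * Var j)"

definition nondegenerate :: "nat \<Rightarrow> 'a::comm_semiring_1 mpoly \<Rightarrow> bool" where
  "nondegenerate n f \<longleftrightarrow> \<not> (\<exists>P\<in>GL n. \<exists>i<n. i \<notin> vars (change_vars n P f))"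

text \<open>
  The cut points \<open>0 = a 0 < a 1 < \<dots> < a t = n\<close> split the variables into \<open>t\<close>
  nonempty consecutive blocks.
\<close>

definition direct_sum :: "nat \<Rightarrow> nat \<Rightarrow> 'a::comm_semiring_1 mpoly \<Rightarrow> bool" where
  "direct_sum n d f \<longleftrightarrow>
     (\<exists>P\<in>GL n. \<exists>t\<ge>2. \<exists>a :: nat \<Rightarrow> nat. \<exists>g :: nat \<Rightarrow> 'a mpoly.
        a 0 = 0 \<and> a t = n \<and>
        (\<forall>s<t. a s < a (Suc s) \<and> form {a s..<a (Suc s)} d (g s)) \<and>
        change_vars n P f = (\<Sum>s<t. g s))"

definition indecomposable :: "nat \<Rightarrow> nat \<Rightarrow> 'a::comm_semiring_1 mpoly \<Rightarrow> bool" where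
  "indecomposable n d f \<longleftrightarrow> \<not> direct_sum n d f"


section \<open>The center\<close>

definition hessian :: "nat \<Rightarrow> 'a::comm_semiring_1 mpoly \<Rightarrow> 'a mpoly mat" where
  "hessian n f = mat n n (\<lambda>(i, j). pderiv_var i (pderiv_var j f))"

definition center :: "nat \<Rightarrow> 'a::comm_semiring_1 mpoly \<Rightarrow> 'a mat set" where
  "center n f = {X \<in> carrier_mat n n.
     transpose_mat (hessian n f * map_mat Const X) = hessian n f * map_mat Const X}"

definition center_ring :: "nat \<Rightarrow> 'a::comm_ring_1 mpoly \<Rightarrow> 'a mat ring" where
  "center_ring n f = (ring_mat TYPE('a) n ()) \<lparr> carrier := center n f \<rparr>"

definition center_dim :: "nat \<Rightarrow> 'a::field mpoly \<Rightarrow> nat" where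
  "center_dim n f =
     vectorspace.dim class_ring ((module_mat TYPE('a) n n) \<lparr> carrier := center n f \<rparr>)"

definition left_ideal :: "'a set \<Rightarrow> ('a, 'b) ring_scheme \<Rightarrow> bool" where
  "left_ideal I R \<longleftrightarrow> additive_subgroup I R \<and> (\<forall>a\<in>carrier R. \<forall>x\<in>I. a \<otimes>\<^bsub>R\<^esub> x \<in> I)"

definition minimal_left_ideal :: "'a set \<Rightarrow> ('a, 'b) ring_scheme \<Rightarrow> bool" where
  "minimal_left_ideal I R \<longleftrightarrow> left_ideal I R \<and> I \<noteq> {\<zero>\<^bsub>R\<^esub>} \<and>
     (\<forall>J. left_ideal J R \<and> J \<subseteq> I \<longrightarrow> J = {\<zero>\<^bsub>R\<^esub>} \<or> J = I)"

text \<open>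
  A ring is semisimple if its left regular module is the direct sum of finitely many simple
  submodules. For a finite-dimensional unital algebra over a field this is semisimplicity as an
  algebra, since all left ideals are subspaces.
\<close>

definition semisimple_ring :: "('a, 'b) ring_scheme \<Rightarrow> bool" where
  "semisimple_ring R \<longleftrightarrow> (\<exists>S. finite S \<and> (\<forall>I\<in>S. minimal_left_ideal I R) \<and>
     bij_betw (\<lambda>x. \<Oplus>\<^bsub>R\<^esub>I\<in>S. x I) (\<Pi>\<^sub>E I\<in>S. I) (carrier R))"


section \<open>The coefficient matrix\<close>

definition tuples :: "nat \<Rightarrow> nat \<Rightarrow> nat list set" where
  "tuples n d = {is. length is = d \<and> set is \<subseteq> {..<n}}"

definition is_sym_coeffs :: "nat \<Rightarrow> nat \<Rightarrow> 'a::comm_semiring_1 mpoly \<Rightarrow> (nat list \<Rightarrow> 'a) \<Rightarrow> bool" where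
  "is_sym_coeffs n d f a \<longleftrightarrow>
     (\<forall>is\<in>tuples n d. \<forall>js\<in>tuples n d. mset is = mset js \<longrightarrow> a is = a js) \<and>
     f = (\<Sum>is\<in>tuples n d. Const (a is) * (\<Prod>i\<leftarrow>is. Var i))"

text \<open>
  On \<open>tuples n d\<close>, such a family exists and is unique if the characteristic is 0 or
  larger than \<open>d\<close>; see \<open>sym_coeffs_exist\<close> and \<open>sym_coeffs_unique\<close> below.
\<close>

definition sym_coeffs :: "nat \<Rightarrow> nat \<Rightarrow> 'a::comm_semiring_1 mpoly \<Rightarrow> nat list \<Rightarrow> 'a" where
  "sym_coeffs n d f = (SOME a. is_sym_coeffs n d f a)"

definition coeff_slice :: "nat \<Rightarrow> nat \<Rightarrow> 'a::comm_semiring_1 mpoly \<Rightarrow> nat list \<Rightarrow> 'a mat" where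
  "coeff_slice n d f is = mat n n (\<lambda>(i, j). sym_coeffs n d f (i # j # is))"

definition kronecker :: "'a::times mat \<Rightarrow> 'a mat \<Rightarrow> 'a mat" where
  "kronecker A B = mat (dim_row A * dim_row B) (dim_col A * dim_col B)
     (\<lambda>(i, j). A $$ (i div dim_row B, j div dim_col B) * B $$ (i mod dim_row B, j mod dim_col B))"

definition vec_of_mat :: "nat \<Rightarrow> 'a mat \<Rightarrow> 'a vec" where
  "vec_of_mat n X = vec (n\<^sup>2) (\<lambda>k. X $$ (k mod n, k div n))"

definition transpose_perm_mat :: "nat \<Rightarrow> 'a::zero_neq_one mat" where
  "transpose_perm_mat n = mat (n\<^sup>2) (n\<^sup>2) (\<lambda>(k, l). if l = (k mod n) * n + k div n then 1 else 0)"

definition B_block :: "nat \<Rightarrow> nat \<Rightarrow> 'a::comm_ring_1 mpoly \<Rightarrow> nat list \<Rightarrow> 'a mat" where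
  "B_block n d f is = kronecker (1\<^sub>m n) (coeff_slice n d f is) -
     kronecker (coeff_slice n d f is) (1\<^sub>m n) * transpose_perm_mat n"

text \<open>
  \<open>product_lists (replicate k [0..<n])\<close> lists all \<open>k\<close>-tuples over \<open>{..<n}\<close>
  in lexicographic order.
\<close>

definition B_mat :: "nat \<Rightarrow> nat \<Rightarrow> 'a::comm_ring_1 mpoly \<Rightarrow> 'a mat" where
  "B_mat n d f = mat_of_rows (n\<^sup>2)
     (concat (map (\<lambda>is. rows (B_block n d f is)) (product_lists (replicate (d - 2) [0..<n]))))"


section \<open>Consistency of the definitions\<close>

lemma transpose_perm_mat_spec:
  fixes X :: "'a::comm_semiring_1 mat"
  assumes X: "X \<in> carrier_mat n n"
  shows "vec_of_mat n (transpose_mat X) = transpose_perm_mat n *\<^sub>v vec_of_mat n X"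
proof (rule eq_vecI)
  fix k assume "k < dim_vec (transpose_perm_mat n *\<^sub>v vec_of_mat n X)"
  hence k: "k < n * n"
    by (simp add: transpose_perm_mat_def power2_eq_square)
  hence n: "n > 0" by (cases n) auto
  have kd: "k div n < n" using k by (simp add: less_mult_imp_div_less)
  have km: "k mod n < n" using n by simp
  let ?l = "(k mod n) * n + k div n"
  have "Suc (k mod n) * n \<le> n * n" using km by (intro mult_le_mono1) simp
  hence l: "?l < n * n" using kd by simp
  have lm: "?l mod n = k div n" using kd by (simp only: mod_mult_self3 mod_less)
  have ld: "?l div n = k mod n" using kd n by (simp only: div_mult_self3 div_less add_0_right neq0_conv)
  have "(transpose_perm_mat n *\<^sub>v vec_of_mat n X) $ k =
      (\<Sum>l<n*n. (if l = ?l then 1 else 0) * X $$ (l mod n, l div n))"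
    using k by (auto simp: transpose_perm_mat_def vec_of_mat_def scalar_prod_def
        power2_eq_square atLeast0LessThan intro!: sum.cong)
  also have "\<dots> = (\<Sum>l<n*n. if l = ?l then X $$ (l mod n, l div n) else 0)"
    by (rule sum.cong) auto
  also have "\<dots> = X $$ (?l mod n, ?l div n)"
    using l by simp
  also have "\<dots> = X $$ (k div n, k mod n)"
    unfolding lm ld ..
  also have "\<dots> = transpose_mat X $$ (k mod n, k div n)"
    using kd km X by (subst index_transpose_mat(1)) auto
  also have "\<dots> = vec_of_mat n (transpose_mat X) $ k"
    unfolding vec_of_mat_def using k by (subst index_vec) (auto simp: power2_eq_square)
  finally show "vec_of_mat n (transpose_mat X) $ k = (transpose_perm_mat n *\<^sub>v vec_of_mat n X) $ k"
    by (rule sym)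
qed (simp add: transpose_perm_mat_def vec_of_mat_def)

lemma B_block_carrier: "B_block n d f is \<in> carrier_mat (n\<^sup>2) (n\<^sup>2)"
  unfolding B_block_def
  by (rule carrier_matI)
    (simp_all only: index_minus_mat index_mult_mat kronecker_def transpose_perm_mat_def dim_row_mat
      dim_col_mat index_one_mat coeff_slice_def power2_eq_square)

lemma length_product_lists_replicate:
  "length (product_lists (replicate k xs)) = length xs ^ k"
  by (induction k) (auto simp: length_concat o_def sum_list_triv)

lemma B_mat_carrier:
  assumes "d \<ge> 2"
  shows "B_mat n d f \<in> carrier_mat (n ^ d) (n\<^sup>2)"
proof -
  have "length (rows (B_block n d f is)) = n\<^sup>2" for "is"
    using B_block_carrier[of n d f "is"] by simp
  hence "length (concat (map (\<lambda>is. rows (B_block n d f is))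
      (product_lists (replicate (d - 2) [0..<n])))) = n ^ (d - 2) * n\<^sup>2"
    by (simp add: length_concat o_def sum_list_triv length_product_lists_replicate)
  also have "\<dots> = n ^ d"
    using assms by (metis le_add_diff_inverse2 power_add)
  finally show ?thesis
    unfolding B_mat_def by (metis mat_of_rows_carrier(1))
qed

lemma finite_tuples: "finite (tuples n d)"
  using finite_lists_length_eq[of "{..<n}" d] by (simp add: tuples_def conj_commute)

definition exponent :: "nat list \<Rightarrow> (nat \<Rightarrow>\<^sub>0 nat)" where
  "exponent is = (\<Sum>i\<leftarrow>is. Poly_Mapping.single i 1)"

lemma lookup_exponent: "Poly_Mapping.lookup (exponent is) i = count (mset is) i"
  by (induction "is") (auto simp: exponent_def lookup_add lookup_single when_def)

lemma exponent_eq_iff: "exponent is = exponent js \<longleftrightarrow> mset is = mset js"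
  by (metis lookup_exponent multiset_eqI poly_mapping_eqI)

lemma Const_mult_Vars:
  "Const c * (\<Prod>i\<leftarrow>is. Var i) = Poly_Mapping.single (exponent is) (c :: 'a::comm_semiring_1)"
proof -
  have "(\<Prod>i\<leftarrow>is. Var i) = Poly_Mapping.single (exponent is) (1 :: 'a)"
    by (induction "is") (simp_all add: exponent_def Var_def mult_single)
  thus ?thesis by (simp add: Const_def mult_single)
qed

lemma lookup_sum_tuples:
  fixes a :: "nat list \<Rightarrow> 'a::comm_semiring_1"
  shows "Poly_Mapping.lookup (\<Sum>is\<in>tuples n d. Const (a is) * (\<Prod>i\<leftarrow>is. Var i)) m =
    (\<Sum>is\<in>{is\<in>tuples n d. exponent is = m}. a is)"
  by (simp add: lookup_sum Const_mult_Vars lookup_single when_def finite_tuples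
      sum.If_cases Int_def)

lemma tuples_exponent_eq:
  assumes "is \<in> tuples n d"
  shows "{js \<in> tuples n d. exponent js = exponent is} = permutations_of_multiset (mset is)"
  using assms by (auto simp: tuples_def exponent_eq_iff permutations_of_multiset_def
      dest: mset_eq_length mset_eq_setD)

lemma of_nat_card_permutations_neq_0:
  assumes "is \<in> tuples n d" and "CHAR('a::field) = 0 \<or> CHAR('a) > d"
  shows "of_nat (card (permutations_of_multiset (mset is))) \<noteq> (0 :: 'a)"
proof -
  have "card (permutations_of_multiset (mset is)) dvd fact d"
    using card_permutations_of_multiset[of "mset is"] assms(1)
    by (metis (mono_tags, lifting) dvd_div_mult_self dvd_triv_left mem_Collect_eq size_mset tuples_def)
  moreover have "of_nat (fact d) \<noteq> (0 :: 'a)"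
  proof
    assume "of_nat (fact d) = (0 :: 'a)"
    moreover have "of_nat (fact d) = (\<Prod>i=1..d. of_nat i :: 'a)"
      by (simp only: fact_prod of_nat_prod of_nat_id)
    ultimately have "(\<Prod>i=1..d. of_nat i :: 'a) = 0"
      by (rule trans[OF sym, rotated])
    then obtain i where "i \<in> {1..d}" "of_nat i = (0 :: 'a)"
      by auto
    thus False using assms(2) by (auto simp: of_nat_eq_0_iff_char_dvd dest: dvd_imp_le)
  qed
  ultimately show ?thesis
    by (metis of_nat_eq_0_iff_char_dvd dvd_trans)
qed

lemma sym_coeffs_unique:
  fixes f :: "'a::field mpoly"
  assumes "is_sym_coeffs n d f a" and "is_sym_coeffs n d f b"
    and "CHAR('a) = 0 \<or> CHAR('a) > d" and "is \<in> tuples n d"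
  shows "a is = b is"
proof -
  have *: "Poly_Mapping.lookup f (exponent is) =
      of_nat (card (permutations_of_multiset (mset is))) * c is"
    if c: "is_sym_coeffs n d f c" for c
  proof -
    have "Poly_Mapping.lookup f (exponent is) = (\<Sum>js\<in>permutations_of_multiset (mset is). c js)"
      using c lookup_sum_tuples[of c n d "exponent is"] tuples_exponent_eq[OF assms(4)]
      unfolding is_sym_coeffs_def by metis
    also have "\<dots> = (\<Sum>js\<in>permutations_of_multiset (mset is). c is)"
    proof (rule sum.cong)
      fix js assume "js \<in> permutations_of_multiset (mset is)"
      hence "js \<in> tuples n d" "mset js = mset is"
        using tuples_exponent_eq[OF assms(4)] by (auto simp: permutations_of_multiset_def)
      thus "c js = c is" using c assms(4) unfolding is_sym_coeffs_def by blast
    qed simp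
    finally show ?thesis by simp
  qed
  show ?thesis
    using *[OF assms(1)] *[OF assms(2)] of_nat_card_permutations_neq_0[OF assms(4,3)] by simp
qed

lemma exponent_surj:
  assumes "Poly_Mapping.keys m \<subseteq> {..<n}" "(\<Sum>i\<in>Poly_Mapping.keys m. Poly_Mapping.lookup m i) = d"
  shows "\<exists>is\<in>tuples n d. exponent is = m"
proof -
  define M where "M = (\<Sum>i\<in>Poly_Mapping.keys m. replicate_mset (Poly_Mapping.lookup m i) i)"
  have cnt: "count M i = Poly_Mapping.lookup m i" for i
    by (auto simp: M_def count_sum in_keys_iff)
  obtain "is" where "is": "mset is = M" using ex_mset by blast
  have "exponent is = m"
    by (rule poly_mapping_eqI) (simp add: lookup_exponent "is" cnt)
  moreover have "length is = d"
    using arg_cong[OF "is", of size] assms(2) by (simp add: M_def)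
  moreover have "set is \<subseteq> {..<n}"
  proof
    fix i assume "i \<in> set is"
    hence "i \<in> Poly_Mapping.keys m"
      using cnt[of i] "is" by (metis count_eq_zero_iff in_keys_iff set_mset_mset)
    thus "i \<in> {..<n}" using assms(1) by blast
  qed
  ultimately show ?thesis by (auto simp: tuples_def)
qed

lemma sym_coeffs_exist:
  fixes f :: "'a::field mpoly"
  assumes f: "form {..<n} d f" and char: "CHAR('a) = 0 \<or> CHAR('a) > d"
  shows "is_sym_coeffs n d f (sym_coeffs n d f)"
proof -
  define a where "a = (\<lambda>is. Poly_Mapping.lookup f (exponent is) /
    of_nat (card (permutations_of_multiset (mset is))))"
  have "f = (\<Sum>is\<in>tuples n d. Const (a is) * (\<Prod>i\<leftarrow>is. Var i))"
  proof (rule poly_mapping_eqI)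
    fix m
    show "Poly_Mapping.lookup f m =
      Poly_Mapping.lookup (\<Sum>is\<in>tuples n d. Const (a is) * (\<Prod>i\<leftarrow>is. Var i)) m"
    proof (cases "\<exists>is\<in>tuples n d. exponent is = m")
      case True
      then obtain "is" where "is": "is \<in> tuples n d" "exponent is = m" by blast
      have "(\<Sum>js\<in>permutations_of_multiset (mset is). a js) =
          (\<Sum>js\<in>permutations_of_multiset (mset is). a is)"
      proof (rule sum.cong)
        fix js assume "js \<in> permutations_of_multiset (mset is)"
        hence "mset js = mset is" by (simp add: permutations_of_multiset_def)
        moreover from this have "exponent js = exponent is" by (simp add: exponent_eq_iff)
        ultimately show "a js = a is" by (simp add: a_def)
      qed simp
      also have "\<dots> = Poly_Mapping.lookup f m"
        using of_nat_card_permutations_neq_0[OF "is"(1) char] "is"(2) by (simp add: a_def)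
      finally show ?thesis
        using tuples_exponent_eq[OF "is"(1)] "is"(2) by (simp add: lookup_sum_tuples)
    next
      case False
      hence "{is \<in> tuples n d. exponent is = m} = {}" by blast
      moreover have "m \<notin> Poly_Mapping.keys f"
        using False f exponent_surj[of m n d] by (auto simp: form_def vars_def)
      ultimately show ?thesis by (simp only: lookup_sum_tuples in_keys_iff sum.empty not_not)
    qed
  qed
  moreover have "a is = a js" if "mset is = mset js" for "is" js
    using that exponent_eq_iff[of "is" js] by (simp add: a_def)
  ultimately have "is_sym_coeffs n d f a"
    unfolding is_sym_coeffs_def by blast
  thus ?thesis unfolding sym_coeffs_def by (rule someI[of "is_sym_coeffs n d f"])
qed

end

theory Submission
  imports Defs "HOL-Algebra.Subrings" "Jordan_Normal_Form.Char_Poly"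
begin

text \<open>
  Being in the center is a linear condition on the coefficients of \<open>f\<close>, and the rows of
  \<open>B\<close> are exactly these conditions on the vectorization of \<open>X\<close>; hence
  \<open>rank B + dim Z(f) = n\<^sup>2\<close>. By the chain rule for Hessians, the center of \<open>f\<close>
  after the change of variables \<open>P\<close> is \<open>P\<^sup>-\<^sup>1 Z(f) P\<close>, and a splitting of the variables
  into two blocks splits the form if and only if the corresponding diagonal idempotent lies in its
  center. So \<open>f\<close> is a direct sum if and only if \<open>Z(f)\<close> contains an idempotent other
  than 0 and 1. If \<open>Z(f)\<close> is semisimple and has no such idempotent, it is a minimal left
  ideal of itself; then \<open>X - k\<close> is zero or invertible for every \<open>X\<close> in the center,
  and choosing for \<open>k\<close> an eigenvalue of \<open>X\<close> shows that \<open>X\<close> is scalar.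
\<close>

section \<open>Substitution and derivatives\<close>

text \<open>The obstacle that shapes the computations is positive characteristic. Differentiation
  multiplies coefficients by exponents, so an equation between second derivatives yields an equation
  between coefficients only where these integers are nonzero in the field. The exponents in a form
  of degree \<open>d\<close> are at most \<open>d\<close>, and a characteristic above
  \<open>d\<close> keeps all the factorials that occur nonzero. Coefficients are therefore rescaled
  by the factorials of their exponents: a derivative becomes a shift, and the symmetric tensor of
  \<open>f\<close> becomes the same family up to the single factor d!. Closure of the center under
  products and the comparison with \<open>B\<close> are then identities between finite sums.

  In the semisimple case, the idempotent is the component of 1 in one of the minimal left ideals;
  when this component is 1 itself, that ideal is the whole ring. On the other side,
  indecomposability and dimension 1 are both compared with one condition: every matrix in the center
  is scalar.\<close>

lemma sum_single_lookup:
  fixes p :: "'a \<Rightarrow>\<^sub>0 'b::comm_monoid_add"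
  shows "(\<Sum>k\<in>Poly_Mapping.keys p. Poly_Mapping.single k (Poly_Mapping.lookup p k)) = p"
proof (rule poly_mapping_eqI)
  fix m
  show "Poly_Mapping.lookup (\<Sum>k\<in>Poly_Mapping.keys p. Poly_Mapping.single k (Poly_Mapping.lookup p k)) m =
      Poly_Mapping.lookup p m"
    by (simp add: lookup_sum lookup_single when_def in_keys_iff)
qed

text \<open>Finite sums of monomials exhaust all polynomials, so an additive property need only be
  checked on monomials. There is no separate case for 0 because a monomial with coefficient 0 is
  already the zero polynomial.\<close>

lemma poly_mapping_single_induct [case_names single add]:
  fixes p :: "'a \<Rightarrow>\<^sub>0 'b::comm_monoid_add"
  assumes single: "\<And>k c. P (Poly_Mapping.single k c)"
    and add: "\<And>p q. P p \<Longrightarrow> P q \<Longrightarrow> P (p + q)"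
  shows "P p"
proof -
  have "P (\<Sum>k\<in>K. Poly_Mapping.single k (Poly_Mapping.lookup p k))" if "finite K" for K
    using that
  proof (induction K rule: finite_induct)
    case empty
    then show ?case using single[of undefined 0] by simp
  qed (simp add: single add)
  from this[of "Poly_Mapping.keys p"] show ?thesis by (simp only: sum_single_lookup finite_keys)
qed

lemma Const_hom:
  "Const 0 = 0" "Const 1 = 1" "Const (a + b) = Const a + Const b"
  "Const (a * b) = Const a * Const (b :: 'a::comm_semiring_1)"
  by (simp_all add: Const_def single_add mult_single)

interpretation Const: comm_semiring_hom "Const :: 'a::comm_semiring_1 \<Rightarrow> 'a mpoly"
  by unfold_locales (simp_all add: Const_hom)

lemma lookup_mult_Const:
  "Poly_Mapping.lookup (f * Const (c :: 'a::comm_semiring_1)) m = Poly_Mapping.lookup f m * c"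
  unfolding Const_def
proof (induction f rule: poly_mapping_single_induct)
  case (single k c)
  then show ?case by (simp add: mult_single lookup_single when_def)
next
  case (add p q)
  then show ?case by (simp add: distrib_right lookup_add)
qed

lemma Var_power: "Var i ^ k = Poly_Mapping.single (Poly_Mapping.single i k) (1 :: 'a::comm_semiring_1)"
  by (induction k) (simp_all add: Var_def mult_single flip: single_add single_one)

lemma prod_single_one:
  "(\<Prod>i\<in>A. Poly_Mapping.single (g i) (1 :: 'a::comm_semiring_1)) = Poly_Mapping.single (\<Sum>i\<in>A. g i) 1"
  by (induction A rule: infinite_finite_induct) (simp_all add: mult_single)

lemma single_eq_monomial:
  "Poly_Mapping.single m (c :: 'a::comm_semiring_1) =
    Const c * (\<Prod>i\<in>Poly_Mapping.keys m. Var i ^ Poly_Mapping.lookup m i)"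
  unfolding Var_power prod_single_one sum_single_lookup by (simp add: Const_def mult_single)

text \<open>Constants and variables generate the polynomials as an algebra. Restricting the
  generators to \<open>V\<close> lets a proof use only the values of a substitution on
  \<open>V\<close>, or only finitely many partial derivatives.\<close>

lemma mpoly_induct [consumes 1, case_names Const Var add mult]:
  fixes f :: "'a::comm_semiring_1 mpoly"
  assumes "vars f \<subseteq> V"
    and Const: "\<And>c. P (Const c)" and Var: "\<And>i. i \<in> V \<Longrightarrow> P (Var i)"
    and add: "\<And>p q. P p \<Longrightarrow> P q \<Longrightarrow> P (p + q)"
    and mult: "\<And>p q. P p \<Longrightarrow> P q \<Longrightarrow> P (p * q)"
  shows "P f"
proof -
  have one: "P 1" and zero: "P 0"
    using Const[of 1] Const[of 0] by (simp_all add: Const_hom)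
  have sum: "P (sum g A)" if "\<And>x. x \<in> A \<Longrightarrow> P (g x)" for g and A :: "(nat \<Rightarrow>\<^sub>0 nat) set"
    using that by (induction A rule: infinite_finite_induct) (auto simp: zero intro: add)
  have prod: "P (prod g A)" if "\<And>x. x \<in> A \<Longrightarrow> P (g x)" for g and A :: "nat set"
    using that by (induction A rule: infinite_finite_induct) (auto simp: one intro: mult)
  have power: "P (p ^ k)" if "P p" for p k
    using that by (induction k) (auto simp: one intro: mult)
  have "P (\<Sum>m\<in>Poly_Mapping.keys f. Poly_Mapping.single m (Poly_Mapping.lookup f m))"
    unfolding single_eq_monomial using assms(1)
    by (intro sum mult Const prod power Var) (auto simp: vars_def)
  thus ?thesis by (simp only: sum_single_lookup)
qed

section \<open>Substitution as a homomorphism of polynomial rings\<close>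

lemma subst_add: "subst \<sigma> (f + g) = subst \<sigma> f + subst \<sigma> g"
  unfolding subst_def by (rule setsum_keys_plus_distrib) (simp_all add: Const_hom distrib_right)

lemma subst_single:
  "subst \<sigma> (Poly_Mapping.single m c) =
    Const c * (\<Prod>i\<in>Poly_Mapping.keys m. \<sigma> i ^ Poly_Mapping.lookup m i)"
  by (simp add: subst_def Const_hom)

lemma subst_Const [simp]: "subst \<sigma> (Const c) = Const c"
  by (simp add: subst_single Const_def[of c])

lemma subst_Var [simp]: "subst \<sigma> (Var i) = \<sigma> i"
  by (simp add: subst_single Var_def Const_hom)

lemma prod_powers_add:
  fixes \<sigma> :: "nat \<Rightarrow> 'b::comm_semiring_1"
  shows "(\<Prod>i\<in>Poly_Mapping.keys (m + m'). \<sigma> i ^ Poly_Mapping.lookup (m + m') i) =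
    (\<Prod>i\<in>Poly_Mapping.keys m. \<sigma> i ^ Poly_Mapping.lookup m i) *
    (\<Prod>i\<in>Poly_Mapping.keys m'. \<sigma> i ^ Poly_Mapping.lookup m' i)"
proof -
  let ?A = "Poly_Mapping.keys m \<union> Poly_Mapping.keys m'"
  \<comment> \<open>All three products are extended to one common index set; the added factors are
    0th powers.\<close>
  have *: "(\<Prod>i\<in>Poly_Mapping.keys k. \<sigma> i ^ Poly_Mapping.lookup k i) =
      (\<Prod>i\<in>?A. \<sigma> i ^ Poly_Mapping.lookup k i)" if "Poly_Mapping.keys k \<subseteq> ?A" for k
    using that by (intro prod.mono_neutral_left) (auto simp: in_keys_iff)
  show ?thesis
    by (subst (1 2 3) *) (auto simp: keys_add[THEN subsetD] lookup_add power_add prod.distrib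
        dest: keys_add[THEN subsetD])
qed

lemma subst_mult: "subst \<sigma> (f * g) = subst \<sigma> f * subst \<sigma> g"
proof (induction f rule: poly_mapping_single_induct)
  case (single m c)
  show ?case
  proof (induction g rule: poly_mapping_single_induct)
    case (single m' c')
    then show ?case by (simp add: mult_single subst_single prod_powers_add Const_hom ac_simps)
  qed (simp add: distrib_left subst_add)
qed (simp add: distrib_right subst_add)

interpretation subst: comm_semiring_hom "subst \<sigma> :: 'a::comm_semiring_1 mpoly \<Rightarrow> 'a mpoly" for \<sigma>
  by unfold_locales
    (simp_all add: subst_add subst_mult subst_Const[of _ 1, unfolded Const_hom]
      subst_Const[of _ 0, unfolded Const_hom])

lemma subst_subst:
  assumes "vars f \<subseteq> V"
  shows "subst \<tau> (subst \<sigma> f) = subst (\<lambda>i. subst \<tau> (\<sigma> i)) f"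
  using assms by (induction rule: mpoly_induct) (simp_all add: subst_add subst_mult)

lemma subst_cong_vars:
  assumes "vars f \<subseteq> V" and "\<And>i. i \<in> V \<Longrightarrow> \<sigma> i = \<tau> i"
  shows "subst \<sigma> f = subst \<tau> f"
  using assms(1) by (induction rule: mpoly_induct) (simp_all add: subst_add subst_mult assms(2))

lemma subst_id:
  "subst Var f = f"
  unfolding subst_def single_eq_monomial[symmetric] by (rule sum_single_lookup)

section \<open>Formal partial derivatives\<close>

lemma pderiv_var_add: "pderiv_var i (f + g) = pderiv_var i f + pderiv_var i g"
  unfolding pderiv_var_def by (rule setsum_keys_plus_distrib) (simp_all add: distrib_left single_add)

lemma pderiv_var_single:
  "pderiv_var i (Poly_Mapping.single m c) =
    Poly_Mapping.single (m - Poly_Mapping.single i 1) (of_nat (Poly_Mapping.lookup m i) * c)"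
  by (simp add: pderiv_var_def)

lemma pderiv_var_Const [simp]: "pderiv_var i (Const c) = 0"
  by (simp add: Const_def pderiv_var_single)

lemma pderiv_var_Var [simp]: "pderiv_var i (Var j) = (if i = j then 1 else 0)"
  by (simp add: Var_def pderiv_var_single lookup_single when_def flip: single_one)

lemma lookup_pderiv_var:
  "Poly_Mapping.lookup (pderiv_var i f) m =
    of_nat (Suc (Poly_Mapping.lookup m i)) * Poly_Mapping.lookup f (m + Poly_Mapping.single i 1)"
proof (induction f rule: poly_mapping_single_induct)
  case (single k c)
  \<comment> \<open>Subtraction of exponents is truncated, so \<open>k\<close> can be recovered from
    \<open>k - e_i\<close> only if the variable \<open>i\<close> occurs in \<open>k\<close>. If it
    does not, the derivative carries the factor 0.\<close>
  have *: "k = m + Poly_Mapping.single i 1"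
    if "k - Poly_Mapping.single i 1 = m" "Poly_Mapping.lookup k i \<noteq> 0"
  proof (rule poly_mapping_eqI)
    fix j
    show "Poly_Mapping.lookup k j = Poly_Mapping.lookup (m + Poly_Mapping.single i 1) j"
      using that(2) by (auto simp: that(1)[symmetric] lookup_add lookup_minus lookup_single when_def)
  qed
  show ?case
  proof (cases "Poly_Mapping.lookup k i = 0")
    case True
    then show ?thesis by (auto simp: pderiv_var_single lookup_single when_def lookup_add)
  next
    case False
    hence "k - Poly_Mapping.single i 1 = m \<longleftrightarrow> k = m + Poly_Mapping.single i 1"
      using * by auto
    then show ?thesis by (auto simp: pderiv_var_single lookup_single when_def lookup_add)
  qed
qed (simp add: pderiv_var_add lookup_add distrib_left)

lemma pderiv_var_mult: "pderiv_var i (f * g) = pderiv_var i f * g + f * pderiv_var i g"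
proof (induction f rule: poly_mapping_single_induct)
  case (single m c)
  show ?case
  proof (induction g rule: poly_mapping_single_induct)
    case (single m' c')
    let ?e = "Poly_Mapping.single i (1::nat)"
    \<comment> \<open>Truncated subtraction can be moved past \<open>k'\<close> when
      \<open>i\<close> occurs in \<open>k\<close>; otherwise the coefficient on both sides is
      0.\<close>
    have *: "Poly_Mapping.single (k + k' - ?e) (of_nat (Poly_Mapping.lookup k i) * d) =
        Poly_Mapping.single (k - ?e + k') (of_nat (Poly_Mapping.lookup k i) * d)" for k k' and d :: 'a
    proof (cases "Poly_Mapping.lookup k i = 0")
      case False
      hence "k + k' - ?e = k - ?e + k'"
        by (intro poly_mapping_eqI) (auto simp: lookup_add lookup_minus lookup_single when_def)
      thus ?thesis by simp
    qed simp
    show ?case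
      using *[of m m' "c * c'"] *[of m' m "c * c'"]
      by (simp add: mult_single pderiv_var_single lookup_add distrib_right single_add mult.assoc)
        (simp add: ac_simps)
  next
    case (add p q)
    show ?case
      unfolding distrib_left pderiv_var_add add by (simp only: ac_simps)
  qed
next
  case (add p q)
  show ?case
    unfolding distrib_right pderiv_var_add add by (simp only: ac_simps)
qed

lemma pderiv_var_sum: "pderiv_var i (sum g A) = (\<Sum>x\<in>A. pderiv_var i (g x))"
  by (induction A rule: infinite_finite_induct)
    (simp_all add: pderiv_var_add pderiv_var_Const[of _ 0, unfolded Const_hom])

lemma vars_pderiv_var: "vars (pderiv_var i f) \<subseteq> vars f"
proof
  fix j assume "j \<in> vars (pderiv_var i f)"
  then obtain m where m: "Poly_Mapping.lookup (pderiv_var i f) m \<noteq> 0" "j \<in> Poly_Mapping.keys m"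
    by (auto simp: vars_def in_keys_iff)
  have "m + Poly_Mapping.single i 1 \<in> Poly_Mapping.keys f"
    using m(1) by (auto simp: lookup_pderiv_var in_keys_iff)
  moreover have "j \<in> Poly_Mapping.keys (m + Poly_Mapping.single i 1)"
    using m(2) by (simp add: in_keys_iff lookup_add)
  ultimately show "j \<in> vars f" unfolding vars_def by blast
qed

text \<open>The chain rule: both sides are additive in \<open>f\<close> and obey the same product
  rule, so agreement on constants and on the variables below \<open>n\<close> suffices.\<close>

lemma pderiv_var_subst:
  assumes "vars f \<subseteq> {..<n}"
  shows "pderiv_var j (subst \<sigma> f) = (\<Sum>i<n. subst \<sigma> (pderiv_var i f) * pderiv_var j (\<sigma> i))"
  using assms
proof (induction rule: mpoly_induct)
  case (Const c)
  then show ?case by simp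
next
  case (Var i)
  have "(\<Sum>k<n. subst \<sigma> (pderiv_var k (Var i)) * pderiv_var j (\<sigma> k)) =
      (\<Sum>k<n. if k = i then pderiv_var j (\<sigma> k) else 0)"
    by (rule sum.cong) simp_all
  then show ?case using Var by simp
next
  case (add p q)
  then show ?case by (simp add: pderiv_var_add subst_add distrib_right sum.distrib)
next
  case (mult p q)
  then show ?case
    by (simp add: pderiv_var_mult subst_add subst_mult distrib_right sum.distrib
        sum_distrib_left sum_distrib_right)
      (simp add: ac_simps)
qed

section \<open>Homogeneity and its behaviour under substitution\<close>

lemma form_iff:
  "form V d f \<longleftrightarrow> (\<forall>m\<in>Poly_Mapping.keys f. Poly_Mapping.keys m \<subseteq> V \<and>
    (\<Sum>i\<in>Poly_Mapping.keys m. Poly_Mapping.lookup m i) = d)"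
  by (auto simp: form_def vars_def)

lemma sum_lookup_add:
  "(\<Sum>i\<in>Poly_Mapping.keys (m + m'). Poly_Mapping.lookup (m + m') i) =
    (\<Sum>i\<in>Poly_Mapping.keys m. Poly_Mapping.lookup m i) +
    (\<Sum>i\<in>Poly_Mapping.keys m'. Poly_Mapping.lookup m' (i::nat) :: nat)"
  by (rule setsum_keys_plus_distrib) simp_all

lemma form_0: "form V d 0"
  by (simp add: form_iff)

lemma form_Const: "form V 0 (Const c)"
  by (simp add: form_iff Const_def)

lemma form_1: "form V 0 1"
  by (simp add: form_iff)

lemma form_add: "form V d f \<Longrightarrow> form V d g \<Longrightarrow> form V d (f + g)"
  using keys_add[of f g] unfolding form_iff by blast

lemma form_mult:
  assumes "form V d f" "form V e g"
  shows "form V (d + e) (f * g)"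
  unfolding form_iff
proof
  fix m assume "m \<in> Poly_Mapping.keys (f * g)"
  then obtain a b where m: "m = a + b" and a: "a \<in> Poly_Mapping.keys f" and b: "b \<in> Poly_Mapping.keys g"
    using keys_mult[of f g] by blast
  have "Poly_Mapping.keys a \<subseteq> V" "Poly_Mapping.keys b \<subseteq> V"
      "(\<Sum>i\<in>Poly_Mapping.keys a. Poly_Mapping.lookup a i) = d"
      "(\<Sum>i\<in>Poly_Mapping.keys b. Poly_Mapping.lookup b i) = e"
    using assms a b unfolding form_iff by simp_all
  thus "Poly_Mapping.keys m \<subseteq> V \<and> (\<Sum>i\<in>Poly_Mapping.keys m. Poly_Mapping.lookup m i) = d + e"
    unfolding m sum_lookup_add using keys_add[of a b] by (auto dest: subsetD)
qed

lemma form_sum: "(\<And>x. x \<in> A \<Longrightarrow> form V d (g x)) \<Longrightarrow> form V d (sum g A)"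
  by (induction A rule: infinite_finite_induct) (auto simp: form_0 intro: form_add)

lemma form_power: "form V d f \<Longrightarrow> form V (d * k) (f ^ k)"
  by (induction k) (simp_all add: form_1 form_mult)

lemma form_prod: "(\<And>x. x \<in> A \<Longrightarrow> form V (d x) (g x)) \<Longrightarrow> form V (sum d A) (prod g A)"
  by (induction A rule: infinite_finite_induct)
    (simp_all add: form_1 form_mult)

lemma form_Var: "i \<in> V \<Longrightarrow> form V 1 (Var i)"
  by (simp add: form_iff Var_def)

lemma form_subst:
  assumes f: "form V d f" and \<sigma>: "\<And>i. i \<in> V \<Longrightarrow> form W 1 (\<sigma> i)"
  shows "form W d (subst \<sigma> f)"
  unfolding subst_def
proof (rule form_sum)
  fix m assume m: "m \<in> Poly_Mapping.keys f"
  have "form W (0 + (\<Sum>i\<in>Poly_Mapping.keys m. 1 * Poly_Mapping.lookup m i))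
      (Const (Poly_Mapping.lookup f m) * (\<Prod>i\<in>Poly_Mapping.keys m. \<sigma> i ^ Poly_Mapping.lookup m i))"
    using m f by (intro form_mult form_Const form_prod form_power \<sigma>) (auto simp: form_iff)
  thus "form W d (Const (Poly_Mapping.lookup f m) *
      (\<Prod>i\<in>Poly_Mapping.keys m. \<sigma> i ^ Poly_Mapping.lookup m i))"
    using m f by (simp add: form_iff)
qed

lemma form_change_vars:
  assumes "form {..<n} d f"
  shows "form {..<n} d (change_vars n P f)"
proof -
  have "form {..<n} (0 + 1) (\<Sum>j<n. Const (P $$ (i, j)) * Var j)" for i
    by (intro form_sum form_mult form_Const form_Var) auto
  thus ?thesis
    using assms unfolding change_vars_def by (intro form_subst) auto
qed

text \<open>Row \<open>i\<close> of \<open>P\<close> lists the coefficients of the linear form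
  replacing the variable \<open>i\<close>. Substituting \<open>Q\<close> into these forms multiplies
  the rows by \<open>Q\<close> from the right, whence the order \<open>P * Q\<close>.\<close>

lemma change_vars_change_vars:
  assumes f: "vars f \<subseteq> {..<n}" and P: "P \<in> carrier_mat n n" and Q: "Q \<in> carrier_mat n n"
  shows "change_vars n Q (change_vars n P f) = change_vars n (P * Q) f"
  unfolding change_vars_def subst_subst[OF f]
proof (rule subst_cong_vars[OF f])
  fix i assume "i \<in> {..<n}"
  hence i: "i < n" by simp
  have "subst (\<lambda>i. \<Sum>j<n. Const (Q $$ (i, j)) * Var j) (\<Sum>j<n. Const (P $$ (i, j)) * Var j) =
      (\<Sum>j<n. \<Sum>l<n. Const (P $$ (i, j)) * (Const (Q $$ (j, l)) * Var l))"
    by (simp add: subst.hom_sum subst_mult sum_distrib_left)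
  also have "\<dots> = (\<Sum>l<n. \<Sum>j<n. Const (P $$ (i, j)) * (Const (Q $$ (j, l)) * Var l))"
    by (rule sum.swap)
  also have "\<dots> = (\<Sum>l<n. Const ((P * Q) $$ (i, l)) * Var l)"
    using P Q i
    by (intro sum.cong) (auto simp: scalar_prod_def Const.hom_sum Const_hom sum_distrib_right
        atLeast0LessThan mult.assoc)
  finally show "subst (\<lambda>i. \<Sum>j<n. Const (Q $$ (i, j)) * Var j) (\<Sum>j<n. Const (P $$ (i, j)) * Var j) =
      (\<Sum>l<n. Const ((P * Q) $$ (i, l)) * Var l)" .
qed

lemma change_vars_one:
  assumes "vars f \<subseteq> {..<n}"
  shows "change_vars n (1\<^sub>m n) f = f"
proof -
  have "subst (\<lambda>i. \<Sum>j<n. Const (1\<^sub>m n $$ (i, j)) * Var j) f = subst Var f"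
  proof (rule subst_cong_vars[OF assms])
    fix i assume i: "i \<in> {..<n}"
    have "(\<Sum>j<n. Const (1\<^sub>m n $$ (i, j)) * Var j) =
        (\<Sum>j<n. if j = i then Var j else (0 :: 'a mpoly))"
      using i by (intro sum.cong) (auto simp: Const_hom)
    thus "(\<Sum>j<n. Const (1\<^sub>m n $$ (i, j)) * Var j) = (Var i :: 'a mpoly)"
      using i by simp
  qed
  thus ?thesis by (simp add: change_vars_def subst_id)
qed

lemma hessian_carrier [simp]:
  "hessian n f \<in> carrier_mat n n" "dim_row (hessian n f) = n" "dim_col (hessian n f) = n"
  by (simp_all add: hessian_def)

text \<open>The derivatives of a linear substitution are the constants \<open>P $$ (i, j)\<close>,
  so applying the chain rule a second time produces no term with a derivative of the
  substitution.\<close>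

lemma hessian_change_vars:
  assumes f: "vars f \<subseteq> {..<n}" and P: "P \<in> carrier_mat n n"
  shows "hessian n (change_vars n P f) =
    transpose_mat (map_mat Const P) * map_mat (change_vars n P) (hessian n f) * map_mat Const P"
    (is "_ = ?R")
proof (rule eq_matI)
  let ?\<sigma> = "\<lambda>i. \<Sum>j<n. Const (P $$ (i, j)) * Var j"
  have d\<sigma>: "pderiv_var j (?\<sigma> i) = Const (P $$ (i, j))" if "j < n" for i j
  proof -
    have "pderiv_var j (?\<sigma> i) = (\<Sum>l<n. if l = j then Const (P $$ (i, l)) else 0)"
      unfolding pderiv_var_sum by (rule sum.cong) (auto simp: pderiv_var_mult)
    thus ?thesis using that by simp
  qed
  fix a b assume "a < dim_row ?R" "b < dim_col ?R"
  hence a: "a < n" and b: "b < n" using P by auto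
  have "pderiv_var a (pderiv_var b (subst ?\<sigma> f)) =
      pderiv_var a (\<Sum>k<n. subst ?\<sigma> (pderiv_var k f) * Const (P $$ (k, b)))"
    by (simp only: pderiv_var_subst[OF f] d\<sigma>[OF b])
  also have "\<dots> = (\<Sum>k<n. pderiv_var a (subst ?\<sigma> (pderiv_var k f)) * Const (P $$ (k, b)))"
    by (simp add: pderiv_var_sum pderiv_var_mult)
  also have "\<dots> = (\<Sum>k<n. (\<Sum>i<n. subst ?\<sigma> (pderiv_var i (pderiv_var k f)) * Const (P $$ (i, a)))
      * Const (P $$ (k, b)))"
  proof (intro sum.cong refl arg_cong2[where f = "(*)"])
    fix k
    have "vars (pderiv_var k f) \<subseteq> {..<n}"
      using vars_pderiv_var f by blast
    thus "pderiv_var a (subst ?\<sigma> (pderiv_var k f)) =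
        (\<Sum>i<n. subst ?\<sigma> (pderiv_var i (pderiv_var k f)) * Const (P $$ (i, a)))"
      by (simp only: pderiv_var_subst d\<sigma>[OF a])
  qed
  also have "\<dots> = ?R $$ (a, b)"
    using a b P
    by (simp add: scalar_prod_def hessian_def change_vars_def atLeast0LessThan mult.commute)
  finally show "hessian n (change_vars n P f) $$ (a, b) = ?R $$ (a, b)"
    using a b by (simp add: hessian_def change_vars_def)
qed (use P in \<open>simp_all add: hessian_def\<close>)

section \<open>The center\<close>

lemma nonzero_of_nat_le:
  assumes "CHAR('a) = 0 \<or> CHAR('a) > d" and "0 < k" "k \<le> d"
  shows "of_nat k \<noteq> (0 :: 'a::semiring_1)"
  using assms by (auto simp: of_nat_eq_0_iff_char_dvd dest: dvd_imp_le)

definition fact_prod :: "(nat \<Rightarrow>\<^sub>0 nat) \<Rightarrow> nat" where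
  "fact_prod m = (\<Prod>i\<in>Poly_Mapping.keys m. fact (Poly_Mapping.lookup m i))"

text \<open>
  Scaling the coefficient of a monomial by the product of the factorials of its exponents turns
  partial derivatives into shifts of the exponent.
\<close>

definition fact_coeff :: "'a::comm_semiring_1 mpoly \<Rightarrow> (nat \<Rightarrow>\<^sub>0 nat) \<Rightarrow> 'a" where
  "fact_coeff f m = of_nat (fact_prod m) * Poly_Mapping.lookup f m"

lemma fact_prod_superset:
  assumes "Poly_Mapping.keys m \<subseteq> A" "finite A"
  shows "fact_prod m = (\<Prod>i\<in>A. fact (Poly_Mapping.lookup m i))"
  unfolding fact_prod_def using assms by (intro prod.mono_neutral_left) (auto simp: in_keys_iff)

lemma fact_prod_add_single:
  "fact_prod (m + Poly_Mapping.single i 1) = Suc (Poly_Mapping.lookup m i) * fact_prod m"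
proof -
  let ?A = "insert i (Poly_Mapping.keys m)" and ?m = "m + Poly_Mapping.single i 1"
  have "fact_prod ?m = (\<Prod>j\<in>?A. fact (Poly_Mapping.lookup ?m j))"
    by (rule fact_prod_superset) (auto dest: keys_add[THEN subsetD])
  also have "\<dots> = fact (Poly_Mapping.lookup ?m i) *
      (\<Prod>j\<in>?A - {i}. fact (Poly_Mapping.lookup ?m j))"
    by (rule prod.remove) auto
  also have "(\<Prod>j\<in>?A - {i}. fact (Poly_Mapping.lookup ?m j) :: nat) =
      (\<Prod>j\<in>?A - {i}. fact (Poly_Mapping.lookup m j))"
    by (rule prod.cong) (auto simp: lookup_add lookup_single)
  also have "fact (Poly_Mapping.lookup ?m i) =
      Suc (Poly_Mapping.lookup m i) * (fact (Poly_Mapping.lookup m i) :: nat)"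
    by (simp add: lookup_add)
  also have "Suc (Poly_Mapping.lookup m i) * (fact (Poly_Mapping.lookup m i) :: nat) *
      (\<Prod>j\<in>?A - {i}. fact (Poly_Mapping.lookup m j)) =
      Suc (Poly_Mapping.lookup m i) * (\<Prod>j\<in>?A. fact (Poly_Mapping.lookup m j))"
    by (simp only: mult.assoc) (subst prod.remove[of ?A i], auto)
  also have "(\<Prod>j\<in>?A. fact (Poly_Mapping.lookup m j)) = fact_prod m"
    by (rule fact_prod_superset[symmetric]) auto
  finally show ?thesis .
qed

lemma fact_coeff_pderiv_var:
  "fact_coeff (pderiv_var i f) m = fact_coeff f (m + Poly_Mapping.single i 1)"
  by (simp only: fact_coeff_def lookup_pderiv_var fact_prod_add_single of_nat_mult ac_simps)

lemma of_nat_fact_prod_neq_0: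
  assumes char: "CHAR('a) = 0 \<or> CHAR('a) > d" and "\<And>i. Poly_Mapping.lookup m i \<le> d"
  shows "of_nat (fact_prod m) \<noteq> (0 :: 'a::idom)"
proof -
  have "of_nat (fact k) \<noteq> (0 :: 'a)" if "k \<le> d" for k
    using that
  proof (induction k)
    case (Suc k)
    then show ?case
      using nonzero_of_nat_le[OF char, of "Suc k"] by (simp only: fact_Suc of_nat_mult) simp
  qed simp
  thus ?thesis using assms(2) by (simp add: fact_prod_def)
qed

lemma pderiv_var_commute: "pderiv_var i (pderiv_var j f) = pderiv_var j (pderiv_var i f)"
proof (rule poly_mapping_eqI)
  fix m
  show "Poly_Mapping.lookup (pderiv_var i (pderiv_var j f)) m =
      Poly_Mapping.lookup (pderiv_var j (pderiv_var i f)) m"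
    by (cases "i = j") (auto simp: lookup_pderiv_var lookup_add lookup_single ac_simps)
qed

lemma form_lookup_neq_0:
  assumes "form V d f" and "Poly_Mapping.lookup f m \<noteq> 0"
  shows "Poly_Mapping.keys m \<subseteq> V" "(\<Sum>i\<in>Poly_Mapping.keys m. Poly_Mapping.lookup m i) = d"
    "Poly_Mapping.lookup m i \<le> d"
proof -
  have m: "m \<in> Poly_Mapping.keys f" using assms(2) by (simp add: in_keys_iff)
  show "Poly_Mapping.keys m \<subseteq> V" "(\<Sum>i\<in>Poly_Mapping.keys m. Poly_Mapping.lookup m i) = d"
    using assms(1) m by (auto simp: form_iff)
  from this(2) show "Poly_Mapping.lookup m i \<le> d"
    by (metis finite_keys in_keys_iff member_le_sum zero_le)
qed

lemma hessian_index:
  "i < n \<Longrightarrow> j < n \<Longrightarrow> hessian n f $$ (i, j) = pderiv_var i (pderiv_var j f)"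
  by (simp add: hessian_def)

lemma hessian_mult_index:
  assumes X: "X \<in> carrier_mat n n" and "i < n" "j < n"
  shows "(hessian n f * map_mat Const X) $$ (i, j) =
    (\<Sum>k<n. pderiv_var i (pderiv_var k f) * Const (X $$ (k, j)))"
  using assms carrier_matD[OF X]
  by (simp add: scalar_prod_def hessian_index atLeast0LessThan)

lemma center_iff_hessian:
  "X \<in> center n f \<longleftrightarrow> X \<in> carrier_mat n n \<and>
    (\<forall>i<n. \<forall>j<n. (\<Sum>k<n. pderiv_var i (pderiv_var k f) * Const (X $$ (k, j))) =
      (\<Sum>k<n. pderiv_var j (pderiv_var k f) * Const (X $$ (k, i))))"
proof (cases "X \<in> carrier_mat n n")
  case True
  let ?A = "hessian n f * map_mat Const X"
  have A: "?A \<in> carrier_mat n n" using True by (auto simp: hessian_def)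
  have "transpose_mat ?A = ?A \<longleftrightarrow> (\<forall>i<n. \<forall>j<n. ?A $$ (i, j) = ?A $$ (j, i))"
  proof
    assume *: "transpose_mat ?A = ?A"
    show "\<forall>i<n. \<forall>j<n. ?A $$ (i, j) = ?A $$ (j, i)"
      using A by (metis * carrier_matD index_transpose_mat(1))
  next
    assume "\<forall>i<n. \<forall>j<n. ?A $$ (i, j) = ?A $$ (j, i)"
    thus "transpose_mat ?A = ?A"
      using A by (intro eq_matI) (simp_all del: index_mult_mat add: carrier_matD[OF A])
  qed
  thus ?thesis
    using True by (simp add: center_def hessian_mult_index del: index_mult_mat)
qed (simp add: center_def)

lemma center_carrier: "X \<in> center n f \<Longrightarrow> X \<in> carrier_mat n n"
  by (simp add: center_def)

text \<open>Coefficients of the entries of the Hessian times \<open>X\<close> are compared monomial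
  by monomial, after scaling by \<open>fact_prod m\<close>. Nothing is lost where this scalar
  vanishes: some exponent of \<open>m\<close> then exceeds \<open>d\<close>, and no second
  derivative of a form of degree \<open>d\<close> contains the monomial \<open>m\<close>.\<close>

lemma center_iff:
  fixes f :: "'a::idom mpoly"
  assumes f: "form {..<n} d f" and char: "CHAR('a) = 0 \<or> CHAR('a) > d"
  shows "X \<in> center n f \<longleftrightarrow> X \<in> carrier_mat n n \<and> (\<forall>m. \<forall>i<n. \<forall>j<n.
    (\<Sum>k<n. fact_coeff f (m + Poly_Mapping.single i 1 + Poly_Mapping.single k 1) * X $$ (k, j)) =
    (\<Sum>k<n. fact_coeff f (m + Poly_Mapping.single j 1 + Poly_Mapping.single k 1) * X $$ (k, i)))"
proof -
  let ?H = "\<lambda>i j. \<Sum>k<n. pderiv_var i (pderiv_var k f) * Const (X $$ (k, j))"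
  let ?c = "\<lambda>m i j. \<Sum>k<n. fact_coeff f (m + Poly_Mapping.single i 1 + Poly_Mapping.single k 1) * X $$ (k, j)"
  have c: "?c m i j = of_nat (fact_prod m) * Poly_Mapping.lookup (?H i j) m" for m i j
  proof -
    have "fact_coeff f (m + Poly_Mapping.single i 1 + Poly_Mapping.single k 1) =
        of_nat (fact_prod m) * Poly_Mapping.lookup (pderiv_var i (pderiv_var k f)) m" for k
      unfolding fact_coeff_pderiv_var[symmetric] by (rule fact_coeff_def)
    thus ?thesis
      by (simp add: lookup_sum lookup_mult_Const sum_distrib_left mult.assoc)
  qed
  have zero: "Poly_Mapping.lookup (?H i j) m = 0" if "of_nat (fact_prod m) = (0 :: 'a)" for m i j
  proof -
    have "Poly_Mapping.lookup (pderiv_var i (pderiv_var k f)) m = 0" for k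
    proof (rule ccontr)
      let ?m = "m + Poly_Mapping.single i 1 + Poly_Mapping.single k 1"
      assume "Poly_Mapping.lookup (pderiv_var i (pderiv_var k f)) m \<noteq> 0"
      hence "Poly_Mapping.lookup f ?m \<noteq> 0"
        by (auto simp: lookup_pderiv_var)
      hence "Poly_Mapping.lookup ?m l \<le> d" for l
        by (rule form_lookup_neq_0(3)[OF f])
      hence "Poly_Mapping.lookup m l \<le> d" for l
        using le_trans[of "Poly_Mapping.lookup m l" "Poly_Mapping.lookup ?m l" d]
        by (simp add: lookup_add)
      thus False using of_nat_fact_prod_neq_0[OF char] that by blast
    qed
    thus ?thesis by (simp add: lookup_sum lookup_mult_Const)
  qed
  have "?H i j = ?H j i \<longleftrightarrow> (\<forall>m. ?c m i j = ?c m j i)" for i j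
  proof
    assume eq: "\<forall>m. ?c m i j = ?c m j i"
    show "?H i j = ?H j i"
    proof (rule poly_mapping_eqI)
      fix m
      show "Poly_Mapping.lookup (?H i j) m = Poly_Mapping.lookup (?H j i) m"
        using eq[rule_format, of m, unfolded c] zero[of m i j] zero[of m j i] by fastforce
    qed
  next
    assume "?H i j = ?H j i"
    thus "\<forall>m. ?c m i j = ?c m j i" by (simp only: c) blast
  qed
  thus ?thesis unfolding center_iff_hessian by blast
qed

text \<open>The defining equations are linear in \<open>X\<close>; for the identity matrix they
  express the symmetry of second derivatives.\<close>

lemma center_closed_linear:
  fixes f :: "'a::idom mpoly"
  shows zero_center: "0\<^sub>m n n \<in> center n f"
    and add_center: "X \<in> center n f \<Longrightarrow> Y \<in> center n f \<Longrightarrow> X + Y \<in> center n f"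
    and smult_center: "X \<in> center n f \<Longrightarrow> a \<cdot>\<^sub>m X \<in> center n f"
    and one_center: "1\<^sub>m n \<in> center n f"
proof -
  show "0\<^sub>m n n \<in> center n f" by (simp add: center_iff_hessian)
  show "X + Y \<in> center n f" if "X \<in> center n f" "Y \<in> center n f"
    using that by (auto simp: center_iff_hessian Const_hom distrib_left sum.distrib)
  show "a \<cdot>\<^sub>m X \<in> center n f" if "X \<in> center n f"
  proof -
    have "(\<Sum>k<n. pderiv_var i (pderiv_var k f) * Const ((a \<cdot>\<^sub>m X) $$ (k, j))) =
        Const a * (\<Sum>k<n. pderiv_var i (pderiv_var k f) * Const (X $$ (k, j)))"
      if "i < n" "j < n" for i j
      using that center_carrier[OF \<open>X \<in> center n f\<close>]
      by (auto simp: Const_hom sum_distrib_left intro!: sum.cong)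
    thus ?thesis using that by (simp add: center_iff_hessian)
  qed
  have "(\<Sum>k<n. pderiv_var i (pderiv_var k f) * Const (1\<^sub>m n $$ (k, j))) =
      pderiv_var i (pderiv_var j f)" if "i < n" "j < n" for i j
  proof -
    have "(\<Sum>k<n. pderiv_var i (pderiv_var k f) * Const (1\<^sub>m n $$ (k, j))) =
        (\<Sum>k<n. if k = j then pderiv_var i (pderiv_var k f) else 0)"
      using that by (intro sum.cong) (auto simp: Const_hom)
    thus ?thesis using that by simp
  qed
  thus "1\<^sub>m n \<in> center n f" by (simp add: center_iff_hessian pderiv_var_commute)
qed

text \<open>
  The \<open>d\<close>-linear form \<open>\<theta>\<close> of \<open>f\<close> satisfies
  \<open>\<theta>(Xu, v, \<dots>) = \<theta>(u, Xv, \<dots>)\<close> for \<open>X\<close> in the center, and likewise for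
  \<open>Y\<close>. As there is a third argument, \<open>\<theta>(XYu, v, w) = \<theta>(Yu, v, Xw) =
  \<theta>(u, Yv, Xw) = \<theta>(u, XYv, w)\<close>.
\<close>

lemma mult_center:
  fixes f :: "'a::idom mpoly"
  assumes f: "form {..<n} d f" and char: "CHAR('a) = 0 \<or> CHAR('a) > d" and d: "d \<ge> 3"
    and X: "X \<in> center n f" and Y: "Y \<in> center n f"
  shows "X * Y \<in> center n f"
proof -
  note center_iff = center_iff[OF f char]
  let ?e = "\<lambda>i. Poly_Mapping.single i (1::nat)"
  let ?c = "fact_coeff f"
  have XY: "X \<in> carrier_mat n n" "Y \<in> carrier_mat n n"
    using X Y by (auto intro: center_carrier)
  have "(\<Sum>k<n. ?c (m + ?e i + ?e k) * (X * Y) $$ (k, j)) =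
      (\<Sum>k<n. ?c (m + ?e j + ?e k) * (X * Y) $$ (k, i))" if i: "i < n" and j: "j < n" for m i j
  \<comment> \<open>A variable \<open>l\<close> dividing the remaining monomial \<open>m\<close>
    serves as the third argument. Without one, a nonzero coefficient would force
    \<open>m = 0\<close> and hence degree 2, contradicting \<open>d \<ge> 3\<close>.\<close>
  proof (cases "\<exists>l<n. l \<in> Poly_Mapping.keys m")
    case True
    then obtain l where l: "l < n" "l \<in> Poly_Mapping.keys m" by blast
    define m' where "m' = m - ?e l"
    have m: "m = m' + ?e l"
      using l(2) by (intro poly_mapping_eqI)
        (auto simp: m'_def lookup_add lookup_minus lookup_single when_def in_keys_iff)
    have S: "(\<Sum>k<n. ?c (m' + ?e a + ?e b + ?e k) * X $$ (k, p)) =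
        (\<Sum>k<n. ?c (m' + ?e a + ?e p + ?e k) * X $$ (k, b))" if "b < n" "p < n" for a b p
      using X that by (simp add: center_iff)
    \<comment> \<open>With \<open>m'\<close> filling the other arguments, \<open>R k i j\<close> is
      \<theta>(e_k, e_i, Y e_j) up to the factor d!, symmetric in \<open>i\<close> and
      \<open>j\<close> because \<open>Y\<close> is in the center. Below, moving \<open>X\<close>
      into slot \<open>l\<close> rewrites \<theta>(e_i, e_l, X Y e_j) as \<theta>(X e_l, e_i, Y
      e_j), which inherits this symmetry.\<close>
    define R where "R k i j = (\<Sum>p<n. ?c (m' + ?e k + ?e i + ?e p) * Y $$ (p, j))" for k i j
    have R: "R k i j = R k j i" for k
      using Y i j by (simp add: center_iff R_def)
    have G: "(\<Sum>k<n. ?c (m + ?e i + ?e k) * (X * Y) $$ (k, j)) = (\<Sum>k<n. X $$ (k, l) * R k i j)"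
      if i: "i < n" and j: "j < n" for i j
    proof -
      have "(\<Sum>k<n. ?c (m + ?e i + ?e k) * (X * Y) $$ (k, j)) =
          (\<Sum>k<n. \<Sum>p<n. ?c (m' + ?e i + ?e l + ?e k) * X $$ (k, p) * Y $$ (p, j))"
        using XY j unfolding m
        by (intro sum.cong) (auto simp: scalar_prod_def atLeast0LessThan sum_distrib_left sum_distrib_right ac_simps)
      also have "\<dots> = (\<Sum>p<n. \<Sum>k<n. ?c (m' + ?e i + ?e l + ?e k) * X $$ (k, p) * Y $$ (p, j))"
        by (rule sum.swap)
      also have "\<dots> = (\<Sum>p<n. (\<Sum>k<n. ?c (m' + ?e i + ?e l + ?e k) * X $$ (k, p)) * Y $$ (p, j))"
        by (simp add: sum_distrib_right)
      also have "\<dots> = (\<Sum>p<n. (\<Sum>k<n. ?c (m' + ?e i + ?e p + ?e k) * X $$ (k, l)) * Y $$ (p, j))"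
        using l(1) by (intro sum.cong arg_cong2[where f = "(*)"] S) auto
      also have "\<dots> = (\<Sum>p<n. \<Sum>k<n. ?c (m' + ?e i + ?e p + ?e k) * X $$ (k, l) * Y $$ (p, j))"
        by (simp add: sum_distrib_right)
      also have "\<dots> = (\<Sum>k<n. \<Sum>p<n. ?c (m' + ?e i + ?e p + ?e k) * X $$ (k, l) * Y $$ (p, j))"
        by (rule sum.swap)
      also have "\<dots> = (\<Sum>k<n. X $$ (k, l) * R k i j)"
        by (simp add: R_def sum_distrib_left ac_simps)
      finally show ?thesis .
    qed
    show ?thesis unfolding G[OF i j] G[OF j i] by (simp only: R)
  next
    case False
    have "?c (m + ?e a + ?e b) = 0" for a b
    proof (rule ccontr)
      let ?m = "m + ?e a + ?e b"
      assume "?c ?m \<noteq> 0"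
      hence nz: "Poly_Mapping.lookup f ?m \<noteq> 0" by (auto simp: fact_coeff_def)
      have "Poly_Mapping.keys m \<subseteq> Poly_Mapping.keys ?m"
        by (auto simp: in_keys_iff lookup_add)
      hence "Poly_Mapping.keys m \<subseteq> {..<n}"
        using form_lookup_neq_0(1)[OF f nz] by (rule order_trans)
      hence "Poly_Mapping.keys m = {}"
        using False by blast
      hence "m = 0" by simp
      hence "(\<Sum>i\<in>Poly_Mapping.keys ?m. Poly_Mapping.lookup ?m i) = 2"
        by (simp only: sum_lookup_add) simp
      thus False using form_lookup_neq_0(2)[OF f nz] d by simp
    qed
    thus ?thesis by simp
  qed
  thus ?thesis using XY by (simp add: center_iff)
qed

text \<open>In the product of the transformed Hessian with \<open>Q * X * P\<close> the inner factor
  \<open>P * Q\<close> cancels. What remains is the congruence by \<open>P\<close> of the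
  substituted matrix \<open>?M\<close>, and congruence preserves symmetry.\<close>

lemma center_change_vars:
  fixes f :: "'a::comm_ring_1 mpoly"
  assumes f: "vars f \<subseteq> {..<n}"
    and P: "P \<in> carrier_mat n n" and Q: "Q \<in> carrier_mat n n" and PQ: "P * Q = 1\<^sub>m n"
    and X: "X \<in> center n f"
  shows "Q * X * P \<in> center n (change_vars n P f)"
proof -
  let ?C = "map_mat Const" and ?c = "map_mat (change_vars n P)"
  let ?H = "hessian n f"
  interpret cv: comm_semiring_hom "change_vars n P :: 'a mpoly \<Rightarrow> 'a mpoly"
    unfolding change_vars_def by unfold_locales
  have cvC: "?c (?C A) = ?C A" for A :: "'a mat"
    by (rule eq_matI) (simp_all add: change_vars_def)
  have Xc: "X \<in> carrier_mat n n" by (rule center_carrier[OF X])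
  let ?M = "?c (?H * ?C X)"
  have M: "?M \<in> carrier_mat n n" using Xc by (auto simp: hessian_def)
  have Mt: "transpose_mat ?M = ?M"
    using X by (simp add: center_def map_mat_transpose)
  have "hessian n (change_vars n P f) * ?C (Q * X * P) =
      (transpose_mat (?C P) * ?c ?H * ?C P) * (?C Q * ?C X * ?C P)"
    using P Q Xc by (simp add: hessian_change_vars[OF f P] Const.mat_hom_mult[of _ n n _ n])
  also have "\<dots> = transpose_mat (?C P) * (?c ?H * ((?C P * ?C Q) * ?C X)) * ?C P"
    using P Q Xc by (simp add: assoc_mult_mat[of _ n n _ n _ n] mult_carrier_mat[of _ n n _ n])
  also have "?C P * ?C Q = 1\<^sub>m n"
    using P Q by (simp add: PQ Const.mat_hom_one flip: Const.mat_hom_mult)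
  also have "?c ?H * (1\<^sub>m n * ?C X) = ?M"
    using Xc by (simp add: cv.mat_hom_mult[of ?H n n _ n] cvC)
  finally have eq: "hessian n (change_vars n P f) * ?C (Q * X * P) = transpose_mat (?C P) * ?M * ?C P" .
  have "transpose_mat (transpose_mat (?C P) * ?M * ?C P) = transpose_mat (?C P) * (transpose_mat ?M * ?C P)"
    using P M by (simp add: transpose_mult[of _ n n _ n])
  also have "\<dots> = transpose_mat (?C P) * ?M * ?C P"
    using P M by (simp add: Mt assoc_mult_mat[of _ n n _ n _ n])
  finally show ?thesis
    using P Q Xc by (simp only: center_def eq mem_Collect_eq mult_carrier_mat[of _ n n _ n] simp_thms)
qed

section \<open>Idempotents and direct sums\<close>

definition block_id :: "nat \<Rightarrow> nat \<Rightarrow> 'a::zero_neq_one mat" where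
  "block_id n r = mat n n (\<lambda>(i, j). if i = j \<and> i < r then 1 else 0)"

lemma block_id_carrier [simp]: "block_id n r \<in> carrier_mat n n"
  by (simp add: block_id_def)

text \<open>Multiplying the Hessian by \<open>block_id n r\<close> keeps its first \<open>r\<close>
  columns and clears the others, so the product is symmetric exactly when the off-diagonal block
  vanishes.\<close>

lemma block_id_in_center_iff:
  "block_id n r \<in> center n f \<longleftrightarrow>
    (\<forall>i<n. \<forall>j<n. i < r \<and> r \<le> j \<longrightarrow> pderiv_var i (pderiv_var j f) = 0)"
proof -
  have "(\<Sum>k<n. pderiv_var i (pderiv_var k f) * Const (block_id n r $$ (k, j))) =
      (if j < r then pderiv_var i (pderiv_var j f) else 0)" if "i < n" "j < n" for i j
  proof -
    have "(\<Sum>k<n. pderiv_var i (pderiv_var k f) * Const (block_id n r $$ (k, j))) =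
        (\<Sum>k<n. if k = j then (if j < r then pderiv_var i (pderiv_var j f) else 0) else 0)"
      using that by (intro sum.cong) (auto simp: block_id_def Const_hom)
    thus ?thesis using that by simp
  qed
  hence "block_id n r \<in> center n f \<longleftrightarrow> (\<forall>i<n. \<forall>j<n.
      (if j < r then pderiv_var i (pderiv_var j f) else 0) =
      (if i < r then pderiv_var j (pderiv_var i f) else 0))"
    by (simp add: center_iff_hessian)
  also have "\<dots> \<longleftrightarrow> (\<forall>i<n. \<forall>j<n. i < r \<and> r \<le> j \<longrightarrow> pderiv_var i (pderiv_var j f) = 0)"
  proof (intro iffI allI impI)
    fix i j assume *: "\<forall>i<n. \<forall>j<n. (if j < r then pderiv_var i (pderiv_var j f) else 0) =
        (if i < r then pderiv_var j (pderiv_var i f) else 0)" and ij: "i < n" "j < n" "i < r \<and> r \<le> j"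
    show "pderiv_var i (pderiv_var j f) = 0"
      using *[rule_format, OF ij(1,2)] ij(3) by (simp add: pderiv_var_commute[of i j])
  next
    fix i j assume *: "\<forall>i<n. \<forall>j<n. i < r \<and> r \<le> j \<longrightarrow> pderiv_var i (pderiv_var j f) = 0"
      and ij: "i < n" "j < n"
    show "(if j < r then pderiv_var i (pderiv_var j f) else 0) =
        (if i < r then pderiv_var j (pderiv_var i f) else 0)"
      using *[rule_format, OF ij] *[rule_format, OF ij(2,1)]
      by (simp add: pderiv_var_commute[of i j] not_less)
  qed
  finally show ?thesis .
qed

lemma pderiv_var_notin_vars: "i \<notin> vars f \<Longrightarrow> pderiv_var i f = 0"
proof (rule poly_mapping_eqI)
  fix m assume "i \<notin> vars f"
  moreover have "i \<in> Poly_Mapping.keys (m + Poly_Mapping.single i (1::nat))"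
    by (simp add: in_keys_iff lookup_add)
  ultimately have "m + Poly_Mapping.single i 1 \<notin> Poly_Mapping.keys f"
    unfolding vars_def by blast
  thus "Poly_Mapping.lookup (pderiv_var i f) m = Poly_Mapping.lookup 0 m"
    by (simp add: lookup_pderiv_var in_keys_iff)
qed

text \<open>\<open>invertible_mat\<close> does not state the shape of the inverse; it is read off
  from the two identity matrices.\<close>

lemma GL_E:
  assumes "P \<in> GL n"
  obtains Q where "P \<in> carrier_mat n n" "Q \<in> carrier_mat n n" "P * Q = 1\<^sub>m n" "Q * P = 1\<^sub>m n"
proof -
  from assms obtain Q where P: "P \<in> carrier_mat n n" and Q: "inverts_mat P Q" "inverts_mat Q P"
    by (auto simp: GL_def invertible_mat_def)
  have PQ: "P * Q = 1\<^sub>m n" and QP: "Q * P = 1\<^sub>m (dim_row Q)"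
    using P Q by (auto simp: inverts_mat_def)
  have "dim_col Q = n" "dim_row Q = n"
    using arg_cong[OF PQ, of dim_col] arg_cong[OF QP, of dim_col] P by auto
  thus thesis using that P PQ QP by auto
qed

lemma GL_I:
  assumes "P \<in> carrier_mat n n" "Q \<in> carrier_mat n n" "P * Q = 1\<^sub>m n" "Q * P = 1\<^sub>m n"
  shows "P \<in> GL n"
  using assms unfolding GL_def invertible_mat_def inverts_mat_def by fastforce

lemma conjugate_cancel:
  fixes P :: "'a::comm_ring_1 mat"
  assumes "P \<in> carrier_mat n n" "Q \<in> carrier_mat n n" "P * Q = 1\<^sub>m n" "X \<in> carrier_mat n n"
  shows "P * (Q * X * P) * Q = X"
proof -
  have "P * (Q * X * P) * Q = (P * Q) * X * (P * Q)"
    using assms(1,2,4) by (simp add: assoc_mult_mat[of _ n n _ n _ n])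
  thus ?thesis using assms by simp
qed

lemma direct_sum_nonscalar:
  fixes f :: "'a::idom mpoly"
  assumes f: "form {..<n} d f" and ds: "direct_sum n d f"
  shows "\<exists>X\<in>center n f. \<forall>c. X \<noteq> c \<cdot>\<^sub>m 1\<^sub>m n"
proof -
  obtain P t a g where P: "P \<in> GL n" and t: "t \<ge> 2" and a: "a 0 = 0" "a t = n"
    and ag: "\<And>s. s < t \<Longrightarrow> a s < a (Suc s)" "\<And>s. s < t \<Longrightarrow> form {a s..<a (Suc s)} d (g s)"
    and g: "change_vars n P f = (\<Sum>s<t. g s)"
    using ds unfolding direct_sum_def by blast
  obtain Q where PQ: "P \<in> carrier_mat n n" "Q \<in> carrier_mat n n" "P * Q = 1\<^sub>m n" "Q * P = 1\<^sub>m n"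
    using GL_E[OF P] .
  \<comment> \<open>Only the first cut matters: all later blocks are merged into one, and
    \<open>t \<ge> 2\<close> makes both parts nonempty.\<close>
  let ?r = "a 1" and ?g = "change_vars n P f"
  have mono: "a s \<le> a s'" if "s \<le> s'" "s' \<le> t" for s s'
    using that
  proof (induction s' rule: dec_induct)
    case (step k)
    then show ?case using ag(1)[of k] by simp
  qed simp
  have r: "0 < ?r" "?r < n"
    using ag(1)[of 0] ag(1)[of 1] mono[of 2 t] t a by (auto simp: numeral_2_eq_2)
  have "block_id n ?r \<in> center n ?g"
    unfolding block_id_in_center_iff
  proof (intro allI impI)
    fix i j assume i: "i < n" and j: "j < n" and ij: "i < ?r \<and> ?r \<le> j"
    have "pderiv_var i (pderiv_var j (g s)) = 0" if s: "s < t" for s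
    proof -
      have v: "vars (g s) \<subseteq> {a s..<a (Suc s)}"
        using ag(2)[OF s] by (simp add: form_def)
      \<comment> \<open>The index \<open>i\<close> lies in the first block and \<open>j\<close>
        beyond it, and each summand lives on one side of the cut.\<close>
      have "i \<notin> vars (g s) \<or> j \<notin> vars (g s)"
      proof (cases "s = 0")
        case False
        hence "?r \<le> a s" using mono[of 1 s] s by simp
        thus ?thesis using v ij by auto
      qed (use v ij a in auto)
      thus ?thesis
        using pderiv_var_notin_vars vars_pderiv_var pderiv_var_commute by (metis subsetD)
    qed
    thus "pderiv_var i (pderiv_var j ?g) = 0"
      unfolding g pderiv_var_sum by simp
  qed
  hence "P * block_id n ?r * Q \<in> center n (change_vars n Q ?g)"
    using PQ form_change_vars[OF f, of P]
    by (intro center_change_vars) (auto simp: form_def)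
  moreover have "change_vars n Q ?g = f"
    using f PQ by (simp add: form_def change_vars_change_vars change_vars_one)
  ultimately have X: "P * block_id n ?r * Q \<in> center n f" by simp
  have "P * block_id n ?r * Q \<noteq> c \<cdot>\<^sub>m 1\<^sub>m n" for c
  proof
    assume eq: "P * block_id n ?r * Q = c \<cdot>\<^sub>m 1\<^sub>m n"
    have "block_id n ?r = Q * (P * block_id n ?r * Q) * P"
      using PQ by (intro conjugate_cancel[symmetric]) auto
    also have "\<dots> = c \<cdot>\<^sub>m 1\<^sub>m n"
      unfolding eq using PQ by (simp add: mult_smult_distrib[of _ n n _ n] mult_smult_assoc_mat[of _ n n _ n])
    finally have *: "block_id n ?r $$ (i, i) = (c \<cdot>\<^sub>m 1\<^sub>m n) $$ (i, i)" for i by simp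
    \<comment> \<open>The diagonal entry at 0 gives \<open>c = 1\<close>, the one at the cut gives
      \<open>c = 0\<close>.\<close>
    show False using *[of 0] *[of ?r] r by (simp add: block_id_def)
  qed
  thus ?thesis using X by blast
qed

lemma form_single: "Poly_Mapping.keys m \<subseteq> V \<Longrightarrow> (\<Sum>i\<in>Poly_Mapping.keys m. Poly_Mapping.lookup m i) = d \<Longrightarrow>
    form V d (Poly_Mapping.single m c)"
  by (simp add: form_iff)

text \<open>The monomials using only variables below \<open>r\<close> form \<open>g1\<close>, all
  others \<open>g2\<close>. A monomial mixing some \<open>i < r\<close> with some
  \<open>j \<ge> r\<close> would survive in the derivative by \<open>i\<close> and \<open>j\<close>,
  multiplied by its two exponents; these are positive and at most \<open>d\<close>, hence nonzero in
  the field.\<close>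

lemma split_form:
  fixes g :: "'a::idom mpoly"
  assumes g: "form {..<n} d g" and char: "CHAR('a) = 0 \<or> CHAR('a) > d"
    and E: "block_id n r \<in> center n g"
  shows "\<exists>g1 g2. form {..<r} d g1 \<and> form {r..<n} d g2 \<and> g = g1 + g2"
proof -
  let ?K = "Poly_Mapping.keys g" and ?s = "\<lambda>m. Poly_Mapping.single m (Poly_Mapping.lookup g m)"
  let ?A = "{m \<in> ?K. Poly_Mapping.keys m \<subseteq> {..<r}}"
  have deg: "(\<Sum>i\<in>Poly_Mapping.keys m. Poly_Mapping.lookup m i) = d" if "m \<in> ?K" for m
    using g that by (simp add: form_iff)
  have "Poly_Mapping.keys m \<subseteq> {r..<n}" if m: "m \<in> ?K" "m \<notin> ?A" for m
  proof
    fix i assume i: "i \<in> Poly_Mapping.keys m"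
    from m have "\<not> Poly_Mapping.keys m \<subseteq> {..<r}" by simp
    then obtain j where j: "j \<in> Poly_Mapping.keys m" "r \<le> j" by (meson lessThan_iff not_le subsetI)
    have n: "i < n" "j < n" using g m(1) i j(1) by (auto simp: form_iff)
    show "i \<in> {r..<n}"
    proof (rule ccontr)
      assume "i \<notin> {r..<n}"
      hence ir: "i < r" using n by simp
      hence ij: "i \<noteq> j" using j by simp
      define m' where "m' = m - Poly_Mapping.single i 1 - Poly_Mapping.single j 1"
      have m': "m = m' + Poly_Mapping.single i 1 + Poly_Mapping.single j 1"
        using i j(1) ij by (intro poly_mapping_eqI)
          (auto simp: m'_def lookup_add lookup_minus lookup_single when_def in_keys_iff)
      have nz: "Poly_Mapping.lookup g m \<noteq> 0" using m(1) by (simp add: in_keys_iff)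
      have pos: "of_nat (Poly_Mapping.lookup m k) \<noteq> (0 :: 'a)" if "k \<in> Poly_Mapping.keys m" for k
        using that form_lookup_neq_0(3)[OF g nz] by (intro nonzero_of_nat_le[OF char]) (auto simp: in_keys_iff)
      have "pderiv_var i (pderiv_var j g) = 0"
        using E n ir j(2) by (simp add: block_id_in_center_iff)
      hence "0 = Poly_Mapping.lookup (pderiv_var i (pderiv_var j g)) m'" by simp
      also have "\<dots> = of_nat (Poly_Mapping.lookup m i) * (of_nat (Poly_Mapping.lookup m j) * Poly_Mapping.lookup g m)"
        using ij by (simp add: lookup_pderiv_var m' lookup_add lookup_single)
      finally show False using nz pos[OF i] pos[OF j(1)] by simp
    qed
  qed
  hence "form {r..<n} d (\<Sum>m\<in>?K - ?A. ?s m)" "form {..<r} d (\<Sum>m\<in>?A. ?s m)"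
    using deg by (intro form_sum form_single; auto)+
  moreover have "g = (\<Sum>m\<in>?A. ?s m) + (\<Sum>m\<in>?K - ?A. ?s m)"
    using sum.subset_diff[of ?A ?K ?s] by (simp add: sum_single_lookup ac_simps)
  ultimately show ?thesis by blast
qed

text \<open>An idempotent \<open>X\<close> fixes its own columns and kills those of
  \<open>1 - X\<close>. Together they span, since \<open>v = X v + (1 - X) v\<close>, so a basis
  consisting of eigenvectors for 1 and 0 can be selected among these columns.\<close>

lemma idempotent_mat_conjugate_block_id:
  fixes X :: "'a::field mat"
  assumes X: "X \<in> carrier_mat n n" and idem: "X * X = X"
  shows "\<exists>P Q r. P \<in> carrier_mat n n \<and> Q \<in> carrier_mat n n \<and> P * Q = 1\<^sub>m n \<and> Q * P = 1\<^sub>m n \<and>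
    r \<le> n \<and> Q * X * P = block_id n r"
proof -
  interpret vec_space "TYPE('a)" n .
  let ?Y = "1\<^sub>m n - X"
  let ?C = "set (cols X) \<union> set (cols ?Y)"
  have Y: "?Y \<in> carrier_mat n n" using X by (rule minus_carrier_mat)
  have XY: "X * ?Y = 0\<^sub>m n n"
    using X by (simp add: mult_minus_distrib_mat[of _ n n _ n] idem)
  have C: "?C \<subseteq> carrier_vec n" using cols_dim[of X] cols_dim[of ?Y] X Y by auto
  have XC: "X *\<^sub>v v = v \<or> X *\<^sub>v v = 0\<^sub>v n" if v: "v \<in> ?C" for v
    using v
  proof
    assume "v \<in> set (cols X)"
    then obtain i where i: "i < n" "v = col X i" using X by (auto simp: cols_def)
    thus ?thesis using col_mult2[OF X X i(1)] by (simp add: idem)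
  next
    assume "v \<in> set (cols ?Y)"
    then obtain i where i: "i < n" "v = col ?Y i" using X by (auto simp: cols_def)
    thus ?thesis using col_mult2[OF X Y i(1)] XY by simp
  qed
  have "span ?C = carrier_vec n"
  proof
    show "span ?C \<subseteq> carrier_vec n" using span_closed[OF C] by blast
    show "carrier_vec n \<subseteq> span ?C"
    proof
      fix v :: "'a vec" assume v: "v \<in> carrier_vec n"
      have "X *\<^sub>v v \<in> col_space X" "?Y *\<^sub>v v \<in> col_space ?Y"
        using col_space_eq[OF X] col_space_eq[OF Y] v X Y by auto
      hence "X *\<^sub>v v \<in> span ?C" "?Y *\<^sub>v v \<in> span ?C"
        unfolding col_space_def using span_is_monotone[of _ ?C] by blast+
      hence "X *\<^sub>v v + ?Y *\<^sub>v v \<in> span ?C" using span_add1[OF C] by blast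
      also have "X *\<^sub>v v + ?Y *\<^sub>v v = v"
        using X v by (intro eq_vecI) (simp_all add: minus_mult_distrib_mat_vec[of _ n n])
      finally show "v \<in> span ?C" .
    qed
  qed
  hence "\<exists>b. b \<subseteq> ?C \<and> minimal b (\<lambda>S. S \<subseteq> carrier_vec n \<and> gen_set S)"
    using C by (intro minimal_exists) auto
  then obtain b where b: "b \<subseteq> ?C" "minimal b (\<lambda>S. S \<subseteq> carrier_vec n \<and> gen_set S)" by blast
  have fin: "finite b" using b(1) by (rule finite_subset) simp
  have basis: "basis b" using b fin by (intro min_gen_is_basis) auto
  have card: "card b = n" using dim_basis[OF fin basis] dim_is_n by simp
  \<comment> \<open>Listing the fixed basis vectors first turns the diagonal form into
    \<open>block_id\<close>, with \<open>r\<close> the number of these vectors.\<close>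
  let ?b1 = "{v \<in> b. X *\<^sub>v v = v}"
  obtain xs ys where xs: "set xs = ?b1" "distinct xs" and ys: "set ys = b - ?b1" "distinct ys"
    using finite_distinct_list[of ?b1] finite_distinct_list[of "b - ?b1"] fin by auto
  let ?vs = "xs @ ys" and ?r = "length xs"
  define P where "P = mat_of_cols n ?vs"
  have vs: "set ?vs = b" "distinct ?vs" using xs ys by auto
  hence len: "length ?vs = n" using card distinct_card[of ?vs] by simp
  have bc: "b \<subseteq> carrier_vec n" using b C by blast
  have P: "P \<in> carrier_mat n n" using len by (auto simp: P_def)
  have cols: "cols P = ?vs" unfolding P_def using vs bc by (intro cols_mat_of_cols) auto
  have "rank P = n"
    using lin_indpt_full_rank[OF P] basis vs unfolding cols basis_def by simp
  hence "det P \<noteq> 0" using det_rank_iff[OF P] by blast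
  \<comment> \<open>The value \<open>undefined\<close> only fills the extension slot of the record
    \<open>ring_mat\<close>.\<close>
  from det_non_zero_imp_unit[OF P this, of undefined] obtain Q where Q: "Q \<in> carrier_mat n n" "Q * P = 1\<^sub>m n" "P * Q = 1\<^sub>m n"
    by (auto simp: Units_def ring_mat_simps)
  have "X * P = P * block_id n ?r"
  proof (rule mat_col_eqI)
    fix i assume "i < dim_col (P * block_id n ?r)"
    hence i: "i < n" by (simp add: block_id_def)
    have coli: "col P i = ?vs ! i"
      using i P by (metis cols cols_nth carrier_matD(2))
    have unit: "P *\<^sub>v unit_vec n i = col P i"
      using P i by (intro eq_vecI) auto
    have zero: "P *\<^sub>v 0\<^sub>v n = 0\<^sub>v n"
      using P by (intro eq_vecI) auto
    have "col (block_id n ?r :: 'a mat) i = (if i < ?r then unit_vec n i else 0\<^sub>v n)"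
      using i by (intro eq_vecI) (auto simp: block_id_def unit_vec_def)
    hence R: "col (P * block_id n ?r) i = (if i < ?r then ?vs ! i else 0\<^sub>v n)"
      using P by (simp add: col_mult2[OF P block_id_carrier i] unit zero coli)
    have "?vs ! i \<in> (if i < ?r then ?b1 else b - ?b1)"
      using i len xs ys nth_mem[of i xs] nth_mem[of "i - ?r" ys] by (auto simp: nth_append)
    hence "X *\<^sub>v (?vs ! i) = (if i < ?r then ?vs ! i else 0\<^sub>v n)"
      using XC b(1) by (auto split: if_splits)
    thus "col (X * P) i = col (P * block_id n ?r) i"
      using col_mult2[OF X P i] by (simp only: coli R)
  qed (use X P in \<open>auto simp: block_id_def\<close>)
  hence "Q * X * P = (Q * P) * block_id n ?r"
    using X P Q(1) assoc_mult_mat[OF Q(1) X P] assoc_mult_mat[OF Q(1) P block_id_carrier] by simp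
  hence "Q * X * P = block_id n ?r"
    by (simp only: Q(2) left_mult_one_mat[OF block_id_carrier])
  moreover have "?r \<le> n" using len by simp
  ultimately show ?thesis using P Q by blast
qed

text \<open>In coordinates where \<open>X\<close> is diagonal, \<open>X\<close> being neither 0 nor
  1 says precisely that both blocks of variables are nonempty.\<close>

lemma idempotent_direct_sum:
  fixes f :: "'a::field mpoly"
  assumes f: "form {..<n} d f" and char: "CHAR('a) = 0 \<or> CHAR('a) > d"
    and X: "X \<in> center n f" and idem: "X * X = X" and "X \<noteq> 0\<^sub>m n n" "X \<noteq> 1\<^sub>m n"
  shows "direct_sum n d f"
proof -
  have Xc: "X \<in> carrier_mat n n" using X by (rule center_carrier)
  obtain P Q r where PQ: "P \<in> carrier_mat n n" "Q \<in> carrier_mat n n" "P * Q = 1\<^sub>m n" "Q * P = 1\<^sub>m n"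
    and r: "r \<le> n" and QXP: "Q * X * P = block_id n r"
    using idempotent_mat_conjugate_block_id[OF Xc idem] by blast
  have XP: "X = P * block_id n r * Q"
    unfolding QXP[symmetric] using PQ Xc by (intro conjugate_cancel[symmetric])
  have "r \<noteq> 0"
  proof
    assume "r = 0"
    hence "block_id n r = (0\<^sub>m n n :: 'a mat)" by (intro eq_matI) (auto simp: block_id_def)
    thus False using XP PQ assms(5) by simp
  qed
  moreover have "r \<noteq> n"
  proof
    assume "r = n"
    hence "block_id n r = (1\<^sub>m n :: 'a mat)" by (intro eq_matI) (auto simp: block_id_def)
    thus False using XP PQ assms(6) by simp
  qed
  ultimately have r: "0 < r" "r < n" using r by auto
  let ?g = "change_vars n P f"
  have "block_id n r \<in> center n ?g"
    unfolding QXP[symmetric] using f PQ X by (intro center_change_vars) (auto simp: form_def)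
  then obtain g1 g2 where g: "form {..<r} d g1" "form {r..<n} d g2" "?g = g1 + g2"
    using split_form[OF form_change_vars[OF f] char] by blast
  let ?a = "\<lambda>s. if s = 0 then 0 else if s = 1 then r else n" and ?gs = "\<lambda>s::nat. if s = 0 then g1 else g2"
  have "\<forall>s<2. ?a s < ?a (Suc s) \<and> form {?a s..<?a (Suc s)} d (?gs s)"
    using r g by (auto simp: less_2_cases_iff lessThan_atLeast0)
  moreover have "?g = (\<Sum>s<2. ?gs s)"
    using g(3) by (simp add: lessThan_Suc numeral_2_eq_2 add.commute)
  ultimately show ?thesis
    unfolding direct_sum_def using GL_I[OF PQ]
    by (intro bexI[of _ P] exI[of _ "2::nat"] exI[of _ ?a] exI[of _ ?gs] conjI) auto
qed

section \<open>The coefficient matrix\<close>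

text \<open>The number d! is \<open>fact_prod\<close> of a \<open>d\<close>-th power of one
  variable.\<close>

lemma of_nat_fact_neq_0:
  assumes char: "CHAR('a) = 0 \<or> CHAR('a) > d"
  shows "of_nat (fact d) \<noteq> (0 :: 'a::idom)"
proof -
  have "fact_prod (Poly_Mapping.single 0 d) = fact d"
    by (cases "d = 0") (simp_all add: fact_prod_def)
  moreover have "Poly_Mapping.lookup (Poly_Mapping.single 0 d) i \<le> d" for i :: nat
    by (simp add: lookup_single when_def)
  ultimately show ?thesis
    using of_nat_fact_prod_neq_0[OF char, of "Poly_Mapping.single 0 d"] by metis
qed

lemma keys_exponent: "Poly_Mapping.keys (exponent is) = set is"
  by (auto simp: in_keys_iff lookup_exponent)

lemma exponent_Cons: "exponent (i # is) = exponent is + Poly_Mapping.single i 1"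
  by (simp add: exponent_def add.commute)

text \<open>A monomial of degree \<open>d\<close> collects one equal tensor entry for each ordering
  of its indices, that is, d! divided by the factorials of its exponents. The scaling in
  \<open>fact_coeff\<close> cancels this denominator and leaves d! uniformly.\<close>

lemma fact_coeff_exponent:
  fixes f :: "'a::field mpoly"
  assumes a: "is_sym_coeffs n d f a" and js: "js \<in> tuples n d"
  shows "fact_coeff f (exponent js) = of_nat (fact d) * a js"
proof -
  have "Poly_Mapping.lookup f (exponent js) = (\<Sum>is\<in>permutations_of_multiset (mset js). a is)"
    using a lookup_sum_tuples[of a n d "exponent js"] tuples_exponent_eq[OF js]
    unfolding is_sym_coeffs_def by metis
  also have "\<dots> = (\<Sum>is\<in>permutations_of_multiset (mset js). a js)"
  proof (rule sum.cong)
    fix "is" assume "is \<in> permutations_of_multiset (mset js)"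
    hence "is \<in> tuples n d" "mset is = mset js"
      using tuples_exponent_eq[OF js] by (auto simp: permutations_of_multiset_def)
    thus "a is = a js" using a js unfolding is_sym_coeffs_def by blast
  qed simp
  finally have lookup: "Poly_Mapping.lookup f (exponent js) =
      of_nat (card (permutations_of_multiset (mset js))) * a js" by simp
  have prod: "fact_prod (exponent js) = (\<Prod>x\<in>set_mset (mset js). fact (count (mset js) x))"
    unfolding fact_prod_def keys_exponent lookup_exponent by simp
  have "size (mset js) = d" using js by (simp add: tuples_def)
  hence "fact_prod (exponent js) * card (permutations_of_multiset (mset js)) = fact d"
    using card_permutations_of_multiset[of "mset js"] unfolding prod by (metis dvd_mult_div_cancel)
  thus ?thesis
    unfolding fact_coeff_def lookup by (metis mult.assoc of_nat_mult)
qed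

text \<open>Up to the nonzero factor d!, the entries of a slice times \<open>X\<close> are the
  scaled coefficients in \<open>center_iff\<close> at the exponent of the remaining
  \<open>d - 2\<close> indices. At any other exponent both sides vanish, by homogeneity of
  \<open>f\<close>.\<close>

lemma center_iff_coeff_slice:
  fixes f :: "'a::field mpoly"
  assumes f: "form {..<n} d f" and char: "CHAR('a) = 0 \<or> CHAR('a) > d" and d: "d \<ge> 2"
    and X: "X \<in> carrier_mat n n"
  shows "X \<in> center n f \<longleftrightarrow> (\<forall>is\<in>tuples n (d - 2).
    transpose_mat (coeff_slice n d f is * X) = coeff_slice n d f is * X)"
proof -
  let ?c = "\<lambda>m i j. \<Sum>k<n. fact_coeff f (m + Poly_Mapping.single i 1 + Poly_Mapping.single k 1) * X $$ (k, j)"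
  let ?A = "\<lambda>is. coeff_slice n d f is * X"
  have slice: "coeff_slice n d f is \<in> carrier_mat n n" for "is"
    by (simp add: coeff_slice_def)
  have A: "of_nat (fact d) * ?A is $$ (i, j) = ?c (exponent is) i j"
    if "is": "is \<in> tuples n (d - 2)" and ij: "i < n" "j < n" for "is" i j
  proof -
    have "fact_coeff f (exponent is + Poly_Mapping.single i 1 + Poly_Mapping.single k 1) =
        of_nat (fact d) * sym_coeffs n d f (i # k # is)" if "k < n" for k
    proof -
      have "i # k # is \<in> tuples n d"
        using "is" ij that d by (auto simp: tuples_def)
      from fact_coeff_exponent[OF sym_coeffs_exist[OF f char] this]
      show ?thesis by (simp add: exponent_Cons ac_simps)
    qed
    thus ?thesis
      using ij X
      by (simp add: coeff_slice_def scalar_prod_def atLeast0LessThan sum_distrib_left mult.assoc)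
  qed
  have zero: "?c m i j = 0"
    if m: "\<not> (\<exists>is\<in>tuples n (d - 2). exponent is = m)" for m i j
  proof -
    have "fact_coeff f (m + Poly_Mapping.single i 1 + Poly_Mapping.single k 1) = 0" for k
    proof (rule ccontr)
      let ?m = "m + Poly_Mapping.single i 1 + Poly_Mapping.single k (1::nat)"
      assume "fact_coeff f ?m \<noteq> 0"
      hence nz: "Poly_Mapping.lookup f ?m \<noteq> 0" by (auto simp: fact_coeff_def)
      have "Poly_Mapping.keys m \<subseteq> Poly_Mapping.keys ?m"
        by (auto simp: in_keys_iff lookup_add)
      hence "Poly_Mapping.keys m \<subseteq> {..<n}"
        using form_lookup_neq_0(1)[OF f nz] by (rule order_trans)
      moreover have "(\<Sum>i\<in>Poly_Mapping.keys m. Poly_Mapping.lookup m i) = d - 2"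
        using form_lookup_neq_0(2)[OF f nz] by (simp only: sum_lookup_add) simp
      ultimately show False using exponent_surj m by blast
    qed
    thus ?thesis by simp
  qed
  have "X \<in> center n f \<longleftrightarrow> (\<forall>m. \<forall>i<n. \<forall>j<n. ?c m i j = ?c m j i)"
    using X by (simp add: center_iff[OF f char])
  also have "\<dots> \<longleftrightarrow> (\<forall>is\<in>tuples n (d - 2). \<forall>i<n. \<forall>j<n. ?c (exponent is) i j = ?c (exponent is) j i)"
    (is "?L \<longleftrightarrow> ?R")
  proof
    assume R: ?R
    show ?L
    proof (intro allI impI)
      fix m i j assume ij: "i < n" "j < n"
      show "?c m i j = ?c m j i"
      proof (cases "\<exists>is\<in>tuples n (d - 2). exponent is = m")
        case True
        thus ?thesis using R ij by blast
      next
        case False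
        show ?thesis unfolding zero[OF False] ..
      qed
    qed
  qed blast
  also have "\<dots> \<longleftrightarrow> (\<forall>is\<in>tuples n (d - 2). \<forall>i<n. \<forall>j<n. ?A is $$ (i, j) = ?A is $$ (j, i))"
  proof -
    have "?c (exponent is) i j = ?c (exponent is) j i \<longleftrightarrow> ?A is $$ (i, j) = ?A is $$ (j, i)"
      if "is \<in> tuples n (d - 2)" "i < n" "j < n" for "is" i j
      unfolding A[OF that, symmetric] A[OF that(1,3,2), symmetric]
      using of_nat_fact_neq_0[OF char] by (metis mult_cancel_left)
    thus ?thesis by blast
  qed
  also have "\<dots> \<longleftrightarrow> (\<forall>is\<in>tuples n (d - 2). transpose_mat (?A is) = ?A is)"
  proof (intro ball_cong refl)
    fix "is"
    have c: "?A is \<in> carrier_mat n n" by (rule mult_carrier_mat[OF slice X])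
    show "(\<forall>i<n. \<forall>j<n. ?A is $$ (i, j) = ?A is $$ (j, i)) \<longleftrightarrow> transpose_mat (?A is) = ?A is"
    proof
      assume "\<forall>i<n. \<forall>j<n. ?A is $$ (i, j) = ?A is $$ (j, i)"
      thus "transpose_mat (?A is) = ?A is"
        using c by (intro eq_matI) (simp_all del: index_mult_mat add: carrier_matD[OF c])
    next
      assume *: "transpose_mat (?A is) = ?A is"
      show "\<forall>i<n. \<forall>j<n. ?A is $$ (i, j) = ?A is $$ (j, i)"
        using c by (metis * carrier_matD index_transpose_mat(1))
    qed
  qed
  finally show ?thesis .
qed

section \<open>Vectorization and Kronecker products\<close>

lemma sum_div_mod:
  fixes g :: "nat \<Rightarrow> nat \<Rightarrow> 'b::comm_monoid_add"
  shows "(\<Sum>l<n * n. g (l div n) (l mod n)) = (\<Sum>a<n. \<Sum>b<n. g a b)"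
proof -
  have "a * n + b < n * n" if "a < n" "b < n" for a b
  proof -
    have "a * n + b < Suc a * n" using that by simp
    also have "\<dots> \<le> n * n" using that by (intro mult_le_mono1) simp
    finally show ?thesis .
  qed
  hence "(\<Sum>l<n * n. g (l div n) (l mod n)) = (\<Sum>(a, b)\<in>{..<n} \<times> {..<n}. g a b)"
    by (intro sum.reindex_bij_witness[of _ "\<lambda>(a, b). a * n + b" "\<lambda>l. (l div n, l mod n)"])
      (auto simp: less_mult_imp_div_less intro!: mod_less_divisor gr0I)
  thus ?thesis by (simp add: sum.cartesian_product)
qed

lemma kronecker_carrier:
  "A \<in> carrier_mat n n \<Longrightarrow> B \<in> carrier_mat n n \<Longrightarrow> kronecker A B \<in> carrier_mat (n\<^sup>2) (n\<^sup>2)"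
  by (auto simp: kronecker_def power2_eq_square)

lemma vec_of_mat_carrier [simp]: "vec_of_mat n X \<in> carrier_vec (n\<^sup>2)"
  by (simp add: vec_of_mat_def)

text \<open>When columns are stacked, position \<open>k\<close> belongs to row
  \<open>k mod n\<close> and column \<open>k div n\<close>. The first Kronecker factor therefore
  combines columns of \<open>X\<close> and the second one acts on its rows.\<close>

lemma kronecker_mult_vec_of_mat:
  fixes A B X :: "'a::comm_ring_1 mat"
  assumes A: "A \<in> carrier_mat n n" and B: "B \<in> carrier_mat n n" and X: "X \<in> carrier_mat n n"
  shows "kronecker A B *\<^sub>v vec_of_mat n X = vec_of_mat n (B * X * transpose_mat A)"
proof (rule eq_vecI)
  fix k assume "k < dim_vec (vec_of_mat n (B * X * transpose_mat A))"
  hence k: "k < n * n" by (simp add: vec_of_mat_def power2_eq_square)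
  hence n: "n > 0" by (cases n) auto
  have kd: "k div n < n" "k mod n < n" using k n by (auto simp: less_mult_imp_div_less)
  have "(kronecker A B *\<^sub>v vec_of_mat n X) $ k =
      (\<Sum>l<n * n. A $$ (k div n, l div n) * B $$ (k mod n, l mod n) * X $$ (l mod n, l div n))"
    using k A B by (simp add: kronecker_def vec_of_mat_def scalar_prod_def power2_eq_square atLeast0LessThan)
  also have "\<dots> = (\<Sum>a<n. \<Sum>b<n. A $$ (k div n, a) * B $$ (k mod n, b) * X $$ (b, a))"
    by (rule sum_div_mod)
  also have "\<dots> = (B * X * transpose_mat A) $$ (k mod n, k div n)"
    using kd A B X
    by (simp add: scalar_prod_def atLeast0LessThan sum_distrib_right sum_distrib_left ac_simps
        del: assoc_mult_mat)
  finally show "(kronecker A B *\<^sub>v vec_of_mat n X) $ k = vec_of_mat n (B * X * transpose_mat A) $ k"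
    using k by (simp add: vec_of_mat_def power2_eq_square)
qed (use A B in \<open>simp add: kronecker_def vec_of_mat_def power2_eq_square\<close>)

lemma vec_of_mat_inj:
  assumes X: "X \<in> carrier_mat n n" and Y: "Y \<in> carrier_mat n n"
    and eq: "vec_of_mat n X = vec_of_mat n Y"
  shows "X = Y"
proof (rule eq_matI)
  fix i j assume "i < dim_row Y" "j < dim_col Y"
  hence ij: "i < n" "j < n" using Y by auto
  have "j * n + i < Suc j * n" using ij by simp
  also have "\<dots> \<le> n * n" using ij by (intro mult_le_mono1) simp
  finally have "vec_of_mat n Z $ (j * n + i) = Z $$ (i, j)" for Z :: "'a mat"
    using ij by (simp add: vec_of_mat_def power2_eq_square)
  thus "X $$ (i, j) = Y $$ (i, j)" using eq by metis
qed (use X Y in auto)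

definition mat_of_vec :: "nat \<Rightarrow> 'a vec \<Rightarrow> 'a mat" where
  "mat_of_vec n v = mat n n (\<lambda>(i, j). v $ (j * n + i))"

lemma mat_of_vec_carrier [simp]: "mat_of_vec n v \<in> carrier_mat n n"
  by (simp add: mat_of_vec_def)

lemma vec_of_mat_of_vec:
  assumes v: "v \<in> carrier_vec (n\<^sup>2)"
  shows "vec_of_mat n (mat_of_vec n v) = v"
proof (rule eq_vecI)
  fix k assume "k < dim_vec v"
  hence k: "k < n * n" using v by (simp add: power2_eq_square)
  hence "n > 0" by (cases n) auto
  thus "vec_of_mat n (mat_of_vec n v) $ k = v $ k"
    using k by (simp add: vec_of_mat_def mat_of_vec_def power2_eq_square less_mult_imp_div_less)
qed (use v in \<open>simp add: vec_of_mat_def\<close>)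

lemma mat_of_vec_of_mat: "X \<in> carrier_mat n n \<Longrightarrow> mat_of_vec n (vec_of_mat n X) = X"
  by (rule vec_of_mat_inj[OF mat_of_vec_carrier _ vec_of_mat_of_vec[OF vec_of_mat_carrier]])

text \<open>With \<open>A\<close> the slice, the first Kronecker term yields the vectorization of
  \<open>A X\<close>; the second, after the permutation has transposed \<open>X\<close>, yields that
  of the transpose of \<open>A X\<close>. The block thus measures the failure of \<open>A X\<close>
  to be symmetric.\<close>

lemma B_block_mult_vec_of_mat:
  fixes f :: "'a::comm_ring_1 mpoly"
  assumes X: "X \<in> carrier_mat n n"
  shows "B_block n d f is *\<^sub>v vec_of_mat n X = 0\<^sub>v (n\<^sup>2) \<longleftrightarrow>
    transpose_mat (coeff_slice n d f is * X) = coeff_slice n d f is * X"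
proof -
  let ?A = "coeff_slice n d f is"
  have A: "?A \<in> carrier_mat n n" by (simp add: coeff_slice_def)
  have P: "transpose_perm_mat n \<in> carrier_mat (n\<^sup>2) (n\<^sup>2)" by (simp add: transpose_perm_mat_def)
  have K: "kronecker ?A (1\<^sub>m n) \<in> carrier_mat (n\<^sup>2) (n\<^sup>2)"
    by (rule kronecker_carrier[OF A one_carrier_mat])
  have "B_block n d f is *\<^sub>v vec_of_mat n X = kronecker (1\<^sub>m n) ?A *\<^sub>v vec_of_mat n X -
      kronecker ?A (1\<^sub>m n) *\<^sub>v (transpose_perm_mat n *\<^sub>v vec_of_mat n X)"
    unfolding B_block_def assoc_mult_mat_vec[OF K P vec_of_mat_carrier, symmetric]
    by (rule minus_mult_distrib_mat_vec[OF kronecker_carrier[OF one_carrier_mat A]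
          mult_carrier_mat[OF K P] vec_of_mat_carrier])
  also have "kronecker (1\<^sub>m n) ?A *\<^sub>v vec_of_mat n X = vec_of_mat n (?A * X)"
    using A X by (simp add: kronecker_mult_vec_of_mat mult_carrier_mat[of _ n n _ n])
  also have "transpose_perm_mat n *\<^sub>v vec_of_mat n X = vec_of_mat n (transpose_mat X)"
    by (rule transpose_perm_mat_spec[OF X, symmetric])
  also have "kronecker ?A (1\<^sub>m n) *\<^sub>v vec_of_mat n (transpose_mat X) =
      vec_of_mat n (transpose_mat (?A * X))"
    using A X by (simp add: kronecker_mult_vec_of_mat transpose_mult)
  finally have "B_block n d f is *\<^sub>v vec_of_mat n X =
      vec_of_mat n (?A * X) - vec_of_mat n (transpose_mat (?A * X))" .
  moreover have "v - w = 0\<^sub>v m \<longleftrightarrow> v = w"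
    if "v \<in> carrier_vec m" "w \<in> carrier_vec m" for v w :: "'a vec" and m
  proof
    assume *: "v - w = 0\<^sub>v m"
    show "v = w"
    proof (rule eq_vecI)
      fix i assume "i < dim_vec w"
      thus "v $ i = w $ i"
        using arg_cong[OF *, of "\<lambda>u. u $ i"] that by simp
    qed (use that in simp)
  qed (use that in simp)
  ultimately have "B_block n d f is *\<^sub>v vec_of_mat n X = 0\<^sub>v (n\<^sup>2) \<longleftrightarrow>
      vec_of_mat n (?A * X) = vec_of_mat n (transpose_mat (?A * X))" by simp
  also have "\<dots> \<longleftrightarrow> transpose_mat (?A * X) = ?A * X"
    using A X vec_of_mat_inj[of "?A * X" n "transpose_mat (?A * X)"] by auto
  finally show ?thesis .
qed

lemma mult_mat_vec_eq_0_iff: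
  assumes "A \<in> carrier_mat m k"
  shows "A *\<^sub>v v = 0\<^sub>v m \<longleftrightarrow> (\<forall>r\<in>set (rows A). r \<bullet> v = 0)"
  using assms by (auto simp: rows_def vec_eq_iff)

lemma set_product_lists_replicate: "set (product_lists (replicate k [0..<n])) = tuples n k"
  by (induction k) (auto simp: tuples_def length_Suc_conv)

lemma B_mat_mult_vec_of_mat:
  fixes f :: "'a::field mpoly"
  assumes f: "form {..<n} d f" and char: "CHAR('a) = 0 \<or> CHAR('a) > d" and d: "d \<ge> 2"
    and X: "X \<in> carrier_mat n n"
  shows "B_mat n d f *\<^sub>v vec_of_mat n X = 0\<^sub>v (n ^ d) \<longleftrightarrow> X \<in> center n f"
proof -
  let ?rs = "concat (map (\<lambda>is. rows (B_block n d f is)) (product_lists (replicate (d - 2) [0..<n])))"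
  have "set (rows (B_block n d f is)) \<subseteq> carrier_vec (n\<^sup>2)" for "is"
    using B_block_carrier[of n d f "is"] rows_carrier[of "B_block n d f is"] by simp
  hence "rows (B_mat n d f) = ?rs"
    unfolding B_mat_def by (intro rows_mat_of_rows) auto
  hence "B_mat n d f *\<^sub>v vec_of_mat n X = 0\<^sub>v (n ^ d) \<longleftrightarrow>
      (\<forall>is\<in>tuples n (d - 2). B_block n d f is *\<^sub>v vec_of_mat n X = 0\<^sub>v (n\<^sup>2))"
    by (auto simp: mult_mat_vec_eq_0_iff[OF B_mat_carrier[OF d]]
        mult_mat_vec_eq_0_iff[OF B_block_carrier] set_product_lists_replicate)
  thus ?thesis
    by (simp add: B_block_mult_vec_of_mat[OF X] center_iff_coeff_slice[OF f char d X])
qed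

text \<open>Independent subsets of \<open>W\<close> remain independent in \<open>V\<close>, so their
  sizes are bounded by \<open>dim\<close>. A maximal one exists and is a finite basis of
  \<open>W\<close>.\<close>

lemma (in vectorspace) subspace_fin_dim:
  assumes W: "subspace K W V" and fd: "fin_dim"
  shows "vectorspace.fin_dim K (vs W)"
proof -
  interpret W: vectorspace K "vs W" using W by (rule subspace_is_vs)
  have sub: "submodule K W V" using W by simp
  have WV: "W \<subseteq> carrier V" using sub by (simp add: submodule_def)
  have li: "finite A \<and> card A \<le> dim" if A: "A \<subseteq> W" "W.lin_indpt A" for A
    using span_li_not_depend(2)[OF A(1) sub] A WV li_le_dim[OF fd, of A] by auto
  have "W.lin_indpt {}" by (unfold W.lin_dep_def) auto
  hence "\<exists>A. finite A \<and> maximal A (\<lambda>S. S \<subseteq> carrier (vs W) \<and> W.lin_indpt S)"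
    using li by (intro maximal_exists[where N = dim and B = "{}"]) auto
  then obtain A where "finite A" "maximal A (\<lambda>S. S \<subseteq> carrier (vs W) \<and> W.lin_indpt S)" by blast
  hence "W.basis A" by (intro W.max_li_is_basis) auto
  thus ?thesis using \<open>finite A\<close> unfolding W.basis_def W.fin_dim_def by blast
qed

text \<open>A single nonzero vector is independent, hence already a basis in dimension 1.\<close>

lemma (in vectorspace) dim_1_multiple:
  assumes fd: "fin_dim" and dim: "dim = 1"
    and v: "v \<in> carrier V" "v \<noteq> \<zero>\<^bsub>V\<^esub>" and w: "w \<in> carrier V"
  shows "\<exists>c\<in>carrier K. w = c \<odot>\<^bsub>V\<^esub> v"
proof -
  have "lin_indpt {}" by (unfold lin_dep_def) auto
  moreover have "v \<notin> span {}" using v(2) by (simp add: span_empty)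
  ultimately have "lin_indpt {v}"
    using lin_dep_iff_in_span[of "{}" v] v(1) by simp
  hence "basis {v}" using v(1) dim by (intro dim_li_is_basis[OF fd]) auto
  hence "w \<in> span {v}" using w by (simp add: basis_def)
  then obtain a A where A: "finite A" "A \<subseteq> {v}" "a \<in> A \<rightarrow> carrier K" "w = lincomb a A"
    unfolding span_def by blast
  show ?thesis
  proof (cases "A = {}")
    case True
    hence "w = \<zero>\<^bsub>K\<^esub> \<odot>\<^bsub>V\<^esub> v" using A(4) v(1) by simp
    thus ?thesis by blast
  next
    case False
    hence "A = {v}" using A(2) by blast
    hence "w = a v \<odot>\<^bsub>V\<^esub> v" "a v \<in> carrier K" using A(3,4) v(1) by (auto simp: lincomb_def)
    thus ?thesis by blast
  qed
qed

lemma linear_map_vec_of_mat: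
  "linear_map (class_ring :: 'a::field ring) (module_mat TYPE('a) n n) (module_vec TYPE('a) (n\<^sup>2)) (vec_of_mat n)"
proof -
  interpret V: vectorspace "class_ring :: 'a ring" "module_mat TYPE('a) n n" by (rule matrix_vs)
  interpret W: vectorspace "class_ring :: 'a ring" "module_vec TYPE('a) (n\<^sup>2)" by (rule vec_vs)
  have "k mod n < n" "k div n < n" if "k < n\<^sup>2" for k
    using that by (cases n; auto simp: power2_eq_square less_mult_imp_div_less)+
  hence "vec_of_mat n \<in> module_hom class_ring (module_mat TYPE('a) n n) (module_vec TYPE('a) (n\<^sup>2))"
    by (auto simp: module_hom_def module_mat_simps module_vec_simps class_ring_simps vec_of_mat_def)
  thus ?thesis by unfold_locales
qed

lemma linear_map_mat_of_vec:
  "linear_map (class_ring :: 'a::field ring) (module_vec TYPE('a) (n\<^sup>2)) (module_mat TYPE('a) n n) (mat_of_vec n)"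
proof -
  interpret V: vectorspace "class_ring :: 'a ring" "module_mat TYPE('a) n n" by (rule matrix_vs)
  interpret W: vectorspace "class_ring :: 'a ring" "module_vec TYPE('a) (n\<^sup>2)" by (rule vec_vs)
  have index: "j * n + i < n\<^sup>2" if "i < n" "j < n" for i j
  proof -
    have "j * n + i < Suc j * n" using that by simp
    also have "\<dots> \<le> n * n" using that by (intro mult_le_mono1) simp
    finally show ?thesis by (simp add: power2_eq_square)
  qed
  have "mat_of_vec n \<in> module_hom class_ring (module_vec TYPE('a) (n\<^sup>2)) (module_mat TYPE('a) n n)"
    by (auto simp: module_hom_def module_mat_simps module_vec_simps class_ring_simps mat_of_vec_def index)
  thus ?thesis by unfold_locales
qed

lemma linear_map_mult_mat_vec:
  assumes A: "A \<in> carrier_mat m k"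
  shows "linear_map (class_ring :: 'a::field ring) (module_vec TYPE('a) k) (module_vec TYPE('a) m) (\<lambda>v. A *\<^sub>v v)"
proof -
  interpret V: vectorspace "class_ring :: 'a ring" "module_vec TYPE('a) k" by (rule vec_vs)
  interpret W: vectorspace "class_ring :: 'a ring" "module_vec TYPE('a) m" by (rule vec_vs)
  have "(\<lambda>v. A *\<^sub>v v) \<in> module_hom class_ring (module_vec TYPE('a) k) (module_vec TYPE('a) m)"
    using A by (auto simp: module_hom_def module_vec_simps class_ring_simps
        mult_add_distrib_mat_vec mult_mat_vec)
  thus ?thesis by unfold_locales
qed

section \<open>Dimension and rank\<close>

lemma module_mat_fin_dim:
  "vectorspace.fin_dim (class_ring :: 'a::field ring) (module_mat TYPE('a) n n)"
  "vectorspace.dim (class_ring :: 'a ring) (module_mat TYPE('a) n n) = n\<^sup>2"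
proof -
  let ?M = "module_mat TYPE('a) n n" and ?V = "module_vec TYPE('a) (n\<^sup>2)"
  interpret lm: linear_map "class_ring :: 'a ring" ?V ?M "mat_of_vec n"
    by (rule linear_map_mat_of_vec)
  have inj: "inj_on (mat_of_vec n) (carrier ?V)"
    by (rule inj_on_inverseI[of _ "vec_of_mat n"]) (simp add: vec_of_mat_of_vec module_vec_simps)
  have surj: "mat_of_vec n ` carrier ?V = carrier ?M"
  proof
    show "carrier ?M \<subseteq> mat_of_vec n ` carrier ?V"
    proof
      fix X assume "X \<in> carrier ?M"
      hence "X = mat_of_vec n (vec_of_mat n X)"
        by (simp add: module_mat_simps mat_of_vec_of_mat)
      thus "X \<in> mat_of_vec n ` carrier ?V"
        by (rule image_eqI) (simp add: module_vec_simps)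
    qed
  qed (auto simp: module_mat_simps)
  show "vectorspace.fin_dim (class_ring :: 'a ring) ?M"
    using lm.surj_fin_dim[OF vec_space.fin_dim surj] .
  show "vectorspace.dim (class_ring :: 'a ring) ?M = n\<^sup>2"
    using lm.dim_eq[OF vec_space.fin_dim inj surj] vec_space.dim_is_n[where 'a = 'a, of "n\<^sup>2"] by simp
qed

text \<open>Rank-nullity for the map \<open>?T\<close> on all \<open>n\<close> by \<open>n\<close>
  matrices. Its kernel is the center, and its image is the column space of \<open>B\<close> because
  every vector of length \<open>n\<^sup>2\<close> is a vectorization.\<close>

lemma rank_add_center_dim:
  fixes f :: "'a::field mpoly"
  assumes f: "form {..<n} d f" and char: "CHAR('a) = 0 \<or> CHAR('a) > d" and d: "d \<ge> 2"
  shows "vec_space.rank (n ^ d) (B_mat n d f) + center_dim n f = n\<^sup>2"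
proof -
  let ?K = "class_ring :: 'a ring" and ?M = "module_mat TYPE('a) n n"
  let ?B = "B_mat n d f" and ?T = "\<lambda>X. B_mat n d f *\<^sub>v vec_of_mat n X"
  have B: "?B \<in> carrier_mat (n ^ d) (n\<^sup>2)" using d by (rule B_mat_carrier)
  interpret v: linear_map ?K ?M "module_vec TYPE('a) (n\<^sup>2)" "vec_of_mat n" by (rule linear_map_vec_of_mat)
  interpret b: linear_map ?K "module_vec TYPE('a) (n\<^sup>2)" "module_vec TYPE('a) (n ^ d)" "\<lambda>v. ?B *\<^sub>v v"
    by (rule linear_map_mult_mat_vec[OF B])
  have "?T \<in> module_hom ?K ?M (module_vec TYPE('a) (n ^ d))"
    using v.f_hom b.f_hom unfolding module_hom_def by (auto simp: Pi_iff)
  then interpret T: linear_map ?K ?M "module_vec TYPE('a) (n ^ d)" ?T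
    by unfold_locales
  have ker: "T.kerT = center n f"
    using B_mat_mult_vec_of_mat[OF f char d] center_carrier[of _ n f]
    by (auto simp: T.ker_def module_mat_simps module_vec_simps)
  have im: "LinearCombinations.module.span ?K (module_vec TYPE('a) (n ^ d)) (set (cols ?B)) = T.imT"
  proof -
    have "{y \<in> carrier_vec (n ^ d). \<exists>x\<in>carrier_vec (n\<^sup>2). ?B *\<^sub>v x = y} = ?T ` carrier_mat n n"
    proof (intro equalityI subsetI)
      fix y assume "y \<in> {y \<in> carrier_vec (n ^ d). \<exists>x\<in>carrier_vec (n\<^sup>2). ?B *\<^sub>v x = y}"
      then obtain x where "x \<in> carrier_vec (n\<^sup>2)" "y = ?B *\<^sub>v x" by blast
      hence "y = ?T (mat_of_vec n x)" by (simp add: vec_of_mat_of_vec)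
      thus "y \<in> ?T ` carrier_mat n n" by (rule image_eqI) simp
    next
      fix y assume "y \<in> ?T ` carrier_mat n n"
      then obtain X where "y = ?B *\<^sub>v vec_of_mat n X" by blast
      thus "y \<in> {y \<in> carrier_vec (n ^ d). \<exists>x\<in>carrier_vec (n\<^sup>2). ?B *\<^sub>v x = y}"
        using mult_mat_vec_carrier[OF B vec_of_mat_carrier] vec_of_mat_carrier by blast
    qed
    thus ?thesis
      using vec_space.col_space_eq[OF B] B
      by (simp add: vec_space.col_space_def T.im_def module_mat_simps)
  qed
  show ?thesis
    using T.rank_nullity[OF module_mat_fin_dim(1)]
    unfolding ker module_mat_fin_dim(2) vec_space.rank_def im center_dim_def .
qed

lemma center_subspace:
  fixes f :: "'a::field mpoly"
  shows "subspace (class_ring :: 'a ring) (center n f) (module_mat TYPE('a) n n)"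
proof -
  interpret M: vectorspace "class_ring :: 'a ring" "module_mat TYPE('a) n n" by (rule matrix_vs)
  have "submodule (class_ring :: 'a ring) (center n f) (module_mat TYPE('a) n n)"
    by (rule submodule.intro)
      (auto simp: module_mat_simps center_closed_linear M.module_axioms dest: center_carrier)
  thus ?thesis unfolding subspace_def using M.vectorspace_axioms by blast
qed

text \<open>For \<open>n \<ge> 1\<close> the identity matrix is a nonzero element of the center, so
  dimension 1 means that it spans.\<close>

lemma center_dim_eq_1_iff:
  fixes f :: "'a::field mpoly"
  assumes n: "n \<ge> 1"
  shows "center_dim n f = 1 \<longleftrightarrow> (\<forall>X\<in>center n f. \<exists>c. X = c \<cdot>\<^sub>m 1\<^sub>m n)"
proof -
  let ?K = "class_ring :: 'a ring" and ?M = "module_mat TYPE('a) n n"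
  let ?C = "?M\<lparr>carrier := center n f\<rparr>"
  have carrier: "carrier ?C = center n f" and smult: "c \<odot>\<^bsub>?C\<^esub> X = c \<cdot>\<^sub>m X" for c X
    by (simp_all add: module_mat_simps)
  have nz: "1\<^sub>m n \<noteq> \<zero>\<^bsub>?C\<^esub>"
  proof
    assume "1\<^sub>m n = \<zero>\<^bsub>?C\<^esub>"
    hence "1\<^sub>m n = (0\<^sub>m n n :: 'a mat)" by (simp add: module_mat_simps)
    from arg_cong[OF this, of "\<lambda>A. A $$ (0, 0)"] show False using n by simp
  qed
  have fin_dim: "vectorspace.fin_dim ?K ?C"
    by (rule vectorspace.subspace_fin_dim[OF matrix_vs center_subspace module_mat_fin_dim(1)])
  interpret C: vectorspace ?K ?C
    by (rule vectorspace.subspace_is_vs[OF matrix_vs center_subspace])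
  have one: "1\<^sub>m n \<in> carrier ?C" unfolding carrier by (rule one_center)
  show ?thesis
  proof
    assume "center_dim n f = 1"
    hence dim: "C.dim = 1" unfolding center_dim_def .
    show "\<forall>X\<in>center n f. \<exists>c. X = c \<cdot>\<^sub>m 1\<^sub>m n"
    proof
      fix X assume "X \<in> center n f"
      hence "X \<in> carrier ?C" unfolding carrier .
      from C.dim_1_multiple[OF fin_dim dim one nz this]
      show "\<exists>c. X = c \<cdot>\<^sub>m 1\<^sub>m n" unfolding smult by (elim bexE) (rule exI)
    qed
  next
    assume *: "\<forall>X\<in>center n f. \<exists>c. X = c \<cdot>\<^sub>m 1\<^sub>m n"
    have sub: "submodule ?K (C.span {1\<^sub>m n}) ?C"
      by (rule C.span_is_submodule) (rule subsetI, erule singletonE, simp only: one)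
    have "carrier ?C \<subseteq> C.span {1\<^sub>m n}"
    proof
      fix X assume "X \<in> carrier ?C"
      hence "\<exists>c. X = c \<cdot>\<^sub>m 1\<^sub>m n" unfolding carrier by (rule bspec[OF *])
      then obtain c where X: "X = c \<odot>\<^bsub>?C\<^esub> 1\<^sub>m n" unfolding smult by (elim exE)
      have "c \<in> carrier ?K" by (simp add: class_ring_simps)
      thus "X \<in> C.span {1\<^sub>m n}"
        unfolding X by (rule submodule.smult_closed[OF sub _ C.span_self[OF one]])
    qed
    with submodule.subset[OF sub] have gen: "C.gen_set {1\<^sub>m n}" by (rule equalityI)
    show "center_dim n f = 1"
      unfolding center_dim_def by (rule C.dim1I[OF gen nz one])
  qed
qed

section \<open>Semisimplicity\<close>

text \<open>Decompose 1 into components \<open>u I\<close>. Uniqueness of decompositions makes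
  \<open>u I\<close> a right identity on \<open>I\<close>, hence idempotent, and nonzero because
  \<open>I\<close> is. If \<open>u I\<close> is 1, then \<open>I\<close> contains every multiple of
  1 and is the whole ring.\<close>

lemma semisimple_ring_cases:
  fixes R (structure)
  assumes "ring R" and ss: "semisimple_ring R" and nz: "\<one> \<noteq> \<zero>"
  shows "minimal_left_ideal (carrier R) R \<or>
    (\<exists>e\<in>carrier R. e \<otimes> e = e \<and> e \<noteq> \<zero> \<and> e \<noteq> \<one>)"
proof -
  interpret ring R by fact
  obtain S where S: "finite S" "\<And>I. I \<in> S \<Longrightarrow> minimal_left_ideal I R"
    and bij: "bij_betw (\<lambda>x. \<Oplus>I\<in>S. x I) (\<Pi>\<^sub>E I\<in>S. I) (carrier R)"
    using ss unfolding semisimple_ring_def by blast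
  let ?sum = "\<lambda>x. \<Oplus>I\<in>S. x I"
  have inj: "inj_on ?sum (\<Pi>\<^sub>E I\<in>S. I)" and surj: "?sum ` (\<Pi>\<^sub>E I\<in>S. I) = carrier R"
    using bij by (simp_all add: bij_betw_def)
  have sub: "I \<subseteq> carrier R" "\<zero> \<in> I" if "I \<in> S" for I
    using S(2)[OF that] by (auto simp: minimal_left_ideal_def left_ideal_def
        dest: additive_subgroup.a_Hcarr additive_subgroup.zero_closed)
  have mult: "a \<otimes> x \<in> I" if "I \<in> S" "a \<in> carrier R" "x \<in> I" for I a x
    using S(2)[OF that(1)] that by (auto simp: minimal_left_ideal_def left_ideal_def)
  have "\<one> \<in> ?sum ` (\<Pi>\<^sub>E I\<in>S. I)" unfolding surj by (rule one_closed)
  then obtain u where u: "u \<in> (\<Pi>\<^sub>E I\<in>S. I)" "?sum u = \<one>" by (elim imageE) simp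
  have uI: "u I \<in> I" if "I \<in> S" for I
    using u(1) that by (rule PiE_mem)
  have uc: "u I \<in> carrier R" if "I \<in> S" for I
    using sub(1)[OF that] uI[OF that] by (rule subsetD)
  have "S \<noteq> {}"
  proof
    assume "S = {}"
    thus False using u(2) nz by simp
  qed
  then obtain I where I: "I \<in> S" by blast
  let ?e = "u I"
  text \<open>Both \<open>(y u\<^sub>J)\<^sub>J\<close> and \<open>y\<close> placed in component \<open>I\<close> sum up to \<open>y\<close>.\<close>
  have ye: "y \<otimes> ?e = y" if y: "y \<in> I" for y
  proof -
    have yc: "y \<in> carrier R" using y sub[OF I] by blast
    let ?x = "\<lambda>J\<in>S. y \<otimes> u J" and ?z = "\<lambda>J\<in>S. if I = J then y else \<zero>"
    have "?sum ?x = (\<Oplus>J\<in>S. y \<otimes> u J)"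
      using yc uc by (intro finsum_cong') simp_all
    also have "\<dots> = y \<otimes> ?sum u"
      using finsum_rdistr[OF S(1) yc, of u] uc by simp
    finally have "?sum ?x = y" using yc u(2) by simp
    moreover have "?sum ?z = (\<Oplus>J\<in>S. if I = J then y else \<zero>)"
      using yc by (intro finsum_cong') simp_all
    hence "?sum ?z = y"
      using finsum_singleton[OF I S(1), of "\<lambda>_. y"] yc by simp
    moreover have "?x \<in> (\<Pi>\<^sub>E I\<in>S. I)"
      using mult[OF _ yc uI] by simp
    moreover have "?z \<in> (\<Pi>\<^sub>E I\<in>S. I)"
      using sub(2) y by (auto simp: Pi_iff)
    ultimately have "?x = ?z"
      by (intro inj_onD[OF inj]) simp_all
    from fun_cong[OF this, of I] show ?thesis using I by simp
  qed
  have "?e \<noteq> \<zero>"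
  proof
    assume "?e = \<zero>"
    hence "y = \<zero>" if "y \<in> I" for y
      using ye[OF that] subsetD[OF sub(1)[OF I] that] by simp
    hence "I = {\<zero>}" using sub(2)[OF I] by blast
    thus False using S(2)[OF I] by (simp add: minimal_left_ideal_def)
  qed
  moreover have "minimal_left_ideal (carrier R) R" if "?e = \<one>"
  proof -
    have "a \<in> I" if "a \<in> carrier R" for a
      using mult[OF I that uI[OF I]] that \<open>?e = \<one>\<close> by simp
    hence "I = carrier R" using sub(1)[OF I] by blast
    thus ?thesis using S(2)[OF I] by simp
  qed
  ultimately show ?thesis using ye[OF uI[OF I]] uc[OF I] by blast
qed

text \<open>The left multiples of \<open>z\<close> form a left ideal containing \<open>z\<close>,
  hence a nonzero one; by minimality it is the whole ring and contains 1.\<close>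

lemma minimal_left_ideal_carrier_inverse:
  fixes R (structure)
  assumes "ring R" and min: "minimal_left_ideal (carrier R) R" and z: "z \<in> carrier R" "z \<noteq> \<zero>"
  shows "\<exists>y\<in>carrier R. y \<otimes> z = \<one>"
proof -
  interpret ring R by fact
  let ?J = "(\<lambda>y. y \<otimes> z) ` carrier R"
  have "subgroup ?J (add_monoid R)"
  proof (rule add.subgroupI)
    show "?J \<subseteq> carrier R" "?J \<noteq> {}" using z by auto
    fix a assume "a \<in> ?J"
    then obtain y where y: "y \<in> carrier R" "a = y \<otimes> z" by blast
    hence "\<ominus> a = (\<ominus> y) \<otimes> z" using z by (simp add: l_minus)
    thus "\<ominus> a \<in> ?J" using y by blast
    fix b assume "b \<in> ?J"
    then obtain x where x: "x \<in> carrier R" "b = x \<otimes> z" by blast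
    have "a \<oplus> b = (y \<oplus> x) \<otimes> z" using x y z by (simp add: l_distr)
    thus "a \<oplus> b \<in> ?J" using x y by blast
  qed
  moreover have "a \<otimes> x \<in> ?J" if "a \<in> carrier R" "x \<in> ?J" for a x
    using that z by (auto simp: m_assoc[symmetric])
  ultimately have "left_ideal ?J R"
    by (auto simp: left_ideal_def intro: additive_subgroupI)
  moreover have "?J \<subseteq> carrier R" using z by auto
  ultimately have "?J = {\<zero>} \<or> ?J = carrier R"
    using min by (simp add: minimal_left_ideal_def)
  moreover have "z \<in> ?J" using z(1) by (intro image_eqI[of _ _ \<one>]) auto
  ultimately have "\<one> \<in> ?J" using z(2) by auto
  thus ?thesis by force
qed

section \<open>The ring structure of the center and the main equivalences\<close>

lemma center_ring_simps:
  "carrier (center_ring n f) = center n f" "mult (center_ring n f) = (*)"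
  "one (center_ring n f) = 1\<^sub>m n" "zero (center_ring n f) = 0\<^sub>m n n"
  by (simp_all add: center_ring_def ring_mat_simps)

lemma ring_center_ring:
  fixes f :: "'a::field mpoly"
  assumes f: "form {..<n} d f" and char: "CHAR('a) = 0 \<or> CHAR('a) > d" and d: "d \<ge> 3"
  shows "ring (center_ring n f)"
proof -
  interpret R: ring "ring_mat TYPE('a) n ()" by (rule ring_mat)
  have "subring (center n f) (ring_mat TYPE('a) n ())"
  proof (rule R.subringI)
    fix X assume X: "X \<in> center n f"
    hence Xc: "X \<in> carrier_mat n n" by (rule center_carrier)
    have "\<ominus>\<^bsub>ring_mat TYPE('a) n ()\<^esub> X = (- 1) \<cdot>\<^sub>m X"
      using Xc by (intro R.minus_equality) (auto simp: ring_mat_simps)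
    thus "\<ominus>\<^bsub>ring_mat TYPE('a) n ()\<^esub> X \<in> center n f" using X by (simp add: smult_center)
  qed (auto simp: ring_mat_simps one_center add_center mult_center[OF f char d] dest: center_carrier)
  thus ?thesis unfolding center_ring_def by (rule R.subring_is_ring)
qed

lemma minimal_center_scalar:
  fixes f :: "'a::alg_closed_field mpoly"
  assumes R: "ring (center_ring n f)" and n: "n \<ge> 1"
    and min: "minimal_left_ideal (carrier (center_ring n f)) (center_ring n f)"
    and X: "X \<in> center n f"
  shows "\<exists>c. X = c \<cdot>\<^sub>m 1\<^sub>m n"
proof -
  have Xc: "X \<in> carrier_mat n n" using X by (rule center_carrier)
  have "degree (char_poly X) > 0" using degree_monic_char_poly[OF Xc] n by simp
  then obtain k where "poly (char_poly X) k = 0"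
    using alg_closed_imp_poly_has_root by blast
  then obtain v where v: "v \<in> carrier_vec n" "v \<noteq> 0\<^sub>v n"
      and char: "char_matrix X k *\<^sub>v v = 0\<^sub>v n"
    using eigenvalue_root_char_poly[OF Xc] Xc
    by (auto simp: eigenvalue_def eigenvector_char_matrix[OF Xc])
  let ?Z = "X + (- k) \<cdot>\<^sub>m 1\<^sub>m n"
  have Z: "?Z \<in> center n f" using X by (intro add_center smult_center one_center)
  have Zc: "?Z \<in> carrier_mat n n" using Z by (rule center_carrier)
  have Zv: "?Z *\<^sub>v v = 0\<^sub>v n"
    using char Xc by (simp add: char_matrix_def)
  \<comment> \<open>A left inverse of \<open>?Z\<close> would recover the nonzero eigenvector
    \<open>v\<close> from \<open>?Z *\<^sub>v v\<close>, which is zero.\<close>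
  have "\<not> (\<exists>Y\<in>center n f. Y * ?Z = 1\<^sub>m n)"
  proof
    assume "\<exists>Y\<in>center n f. Y * ?Z = 1\<^sub>m n"
    then obtain Y where Y: "Y \<in> carrier_mat n n" "Y * ?Z = 1\<^sub>m n" by (auto dest: center_carrier)
    have "v = (Y * ?Z) *\<^sub>v v" using Y(2) v(1) by simp
    also have "\<dots> = Y *\<^sub>v (?Z *\<^sub>v v)" by (rule assoc_mult_mat_vec[OF Y(1) Zc v(1)])
    also have "\<dots> = 0\<^sub>v n" unfolding Zv using Y(1) by (intro eq_vecI) auto
    finally show False using v(2) by simp
  qed
  hence Z0: "?Z = 0\<^sub>m n n"
    using minimal_left_ideal_carrier_inverse[OF R min, of ?Z] Z by (auto simp: center_ring_simps)
  have "X $$ (i, j) = (k \<cdot>\<^sub>m 1\<^sub>m n) $$ (i, j)" if "i < n" "j < n" for i j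
    using arg_cong[OF Z0, of "\<lambda>A. A $$ (i, j)"] that Xc by (auto split: if_splits)
  hence "X = k \<cdot>\<^sub>m 1\<^sub>m n"
    using Xc by (intro eq_matI) auto
  thus ?thesis by blast
qed

theorem corollary3p9:
  fixes f :: "'k::alg_closed_field mpoly" and n d :: nat
  assumes "d \<ge> 3" and "n \<ge> 1"
    and "CHAR('k) = 0 \<or> CHAR('k) > d"
    and "form {..<n} d f"
    and "nondegenerate n f"
    and "semisimple_ring (center_ring n f)"
  shows "(indecomposable n d f \<longleftrightarrow> center_dim n f = 1) \<and>
         (center_dim n f = 1 \<longleftrightarrow> vec_space.rank (n ^ d) (B_mat n d f) = n\<^sup>2 - 1)"
proof
  note d = \<open>d \<ge> 3\<close> and n = \<open>n \<ge> 1\<close> and f = \<open>form {..<n} d f\<close>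
    and char = \<open>CHAR('k) = 0 \<or> CHAR('k) > d\<close>
  have R: "ring (center_ring n f)" by (rule ring_center_ring[OF f char d])
  show "indecomposable n d f \<longleftrightarrow> center_dim n f = 1"
    unfolding center_dim_eq_1_iff[OF n]
  proof
    assume ind: "indecomposable n d f"
    have "\<one>\<^bsub>center_ring n f\<^esub> \<noteq> \<zero>\<^bsub>center_ring n f\<^esub>"
    proof
      assume "\<one>\<^bsub>center_ring n f\<^esub> = \<zero>\<^bsub>center_ring n f\<^esub>"
      hence "1\<^sub>m n = (0\<^sub>m n n :: 'k mat)" by (simp add: center_ring_simps)
      from arg_cong[OF this, of "\<lambda>A. A $$ (0, 0)"] show False using n by simp
    qed
    moreover have "\<not> (\<exists>e\<in>center n f. e * e = e \<and> e \<noteq> 0\<^sub>m n n \<and> e \<noteq> 1\<^sub>m n)"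
      using idempotent_direct_sum[OF f char] ind by (auto simp: indecomposable_def)
    ultimately have "minimal_left_ideal (carrier (center_ring n f)) (center_ring n f)"
      using semisimple_ring_cases[OF R \<open>semisimple_ring (center_ring n f)\<close>]
      by (auto simp: center_ring_simps)
    thus "\<forall>X\<in>center n f. \<exists>c. X = c \<cdot>\<^sub>m 1\<^sub>m n"
      using minimal_center_scalar[OF R n] by blast
  next
    assume "\<forall>X\<in>center n f. \<exists>c. X = c \<cdot>\<^sub>m 1\<^sub>m n"
    thus "indecomposable n d f"
      using direct_sum_nonscalar[OF f] unfolding indecomposable_def by blast
  qed
  have "vec_space.rank (n ^ d) (B_mat n d f) + center_dim n f = n\<^sup>2"
    using d by (intro rank_add_center_dim[OF f char]) simp
  \<comment> \<open>This keeps the subtraction in \<open>n\<^sup>2 - 1\<close>, taken in the natural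
    numbers, from being truncated.\<close>
  moreover have "n\<^sup>2 \<ge> 1" using n by simp
  ultimately show "center_dim n f = 1 \<longleftrightarrow> vec_space.rank (n ^ d) (B_mat n d f) = n\<^sup>2 - 1"
    by linarith
qed

end
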